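(* Let $-\infty<\alpha<\beta\le\alpha+2\pi$, let $\nu$ be a charge on $\mathbb{C}$ of finite type at order $p\in\mathbb{R}^+$ near $\infty$, let $q=\bigl[\frac{\beta-\alpha}\pi p\bigr]$, and suppose $D(r_0)\cap\operatorname{supp}\nu=\varnothing$ for some $r_0>0$. 1. The balayage $\nu^{\mathrm{bal}[q]}_{\mathbb{C}\setminus\angle(\alpha,\beta)}$ of genus $q$ from $\angle(\alpha,\beta)$ exists, and there is a constant $C$ (depending on $\nu,p,\alpha,\beta$) such that for all $r\ge0$ $$\bigl|\nu^{\mathrm{bal}[q]}_{\mathbb{C}\setminus\angle(\alpha,\beta)}\bigr|^{\rm rad}(r)\le C\Bigl(r^p+r^{\frac{\pi q}{\beta-\alpha}}\Bigl|\int_{(D(r)\setminus D(r_0))\cap\angle(\alpha,\beta)}\operatorname{Im}\frac1{(ze^{-i\alpha})^{\frac{\pi q}{\beta-\alpha}}}d\nu(z)\Bigr|\Bigr).$$ 2. For every $p$, $|\nu^{\mathrm{bal}[q]}_{\mathbb{C}\setminus\angle(\alpha,\beta)}|^{\rm rad}(r)=O(r^p\log r)$ as $r\to+\infty$. 3. If $\frac{\beta-\alpha}\pi p\notin\mathbb{N}_0$, then $\nu^{\mathrm{bal}[q]}_{\mathbb{C}\setminus\angle(\alpha,\beta)}$ is of finite type at order $p$. 4. If $q=\frac{\beta-\alpha}\pi p\in\mathbb{N}_0$ and $\bigl|\int_{(D(r)\setminus D(r_0))\cap\angle(\alpha,\beta)}\operatorname{Im}\frac1{(ze^{-i\alpha})^p}d\nu(z)\bigr|=O(1)$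 as $r\to+\infty$ (Blaschke condition of genus $p$), then $\nu^{\mathrm{bal}[q]}_{\mathbb{C}\setminus\angle(\alpha,\beta)}$ is of finite type at order $p$.
   Context: A charge is a real Borel signed measure on $\mathbb{C}$ finite on bounded sets; $|\nu|^{\rm rad}(r)=|\nu|(\{|z|\le r\})$; finite type at order $p$ means $\limsup_{r\to\infty}|\nu|^{\rm rad}(r)/r^p<\infty$. $\angle(\alpha,\beta)=\{re^{i\theta}:r>0,\theta\in(\alpha,\beta)\}$; for $z=re^{i\theta}$ in it and $s>0$, $(ze^{-i\alpha})^s=r^se^{is(\theta-\alpha)}$. Put $\tilde z=(ze^{-i\alpha})^{\pi/(\beta-\alpha)}\in\{\operatorname{Im}w>0\}$. For bounded Borel $B$, $\tilde B=\{t\ge0:t^{(\beta-\alpha)/\pi}e^{i\alpha}\in B\}\cup\{t\le0:|t|^{(\beta-\alpha)/\pi}e^{i\beta}\in B\}\subset\mathbb{R}$ (the two sides treated as distinct even if $\beta=\alpha+2\pi$). Harmonic charge of genus $q$: $\Omega^{[q]}_{\angle(\alpha,\beta)}(z,B)=\frac1\pi\int_{\tilde B}\operatorname{Im}\frac1{t-\tilde z}dt+\frac1\pi\sum_{k=1}^q\operatorname{Im}(\tilde z^{-k})\int_{\tilde B}t^{k-1}dt$. Balayage of genus $q$ from the angle: $\nu^{\mathrm{bal}[q]}_{\mathbb{C}\setminus\angle(\alpha,\beta)}(B)=\int_{\angle(\alpha,\beta)}\Omega^{[q]}_{\angle(\alpha,\beta)}(z,B)d\nu(z)+\nu(B\setminus\angle(\alpha,\beta))$.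 *)

theory Defs
  imports "HOL-Analysis.Analysis"
begin

text \<open>A charge \<nu> on the complex plane is represented by its Jordan decomposition:
  two Borel measures nuP, nuN on the complex plane, finite on bounded sets, mutually singular;
  then nu = nuP - nuN (on bounded Borel sets) and the total variation is nuP + nuN.\<close>

definition is_charge :: "complex measure \<Rightarrow> complex measure \<Rightarrow> bool" where
  "is_charge nuP nuN \<longleftrightarrow>
     sets nuP = sets borel \<and> sets nuN = sets borel \<and>
     (\<forall>r. emeasure nuP (cball 0 r) < \<infinity> \<and> emeasure nuN (cball 0 r) < \<infinity>) \<and>
     (\<exists>S\<in>sets borel. emeasure nuP S = 0 \<and> emeasure nuN (UNIV - S) = 0)"

definition charge_rad :: "complex measure \<Rightarrow> complex measure \<Rightarrow> real \<Rightarrow> ennreal" where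
  "charge_rad nuP nuN r = emeasure nuP (cball 0 r) + emeasure nuN (cball 0 r)"

definition charge_integral ::
  "complex measure \<Rightarrow> complex measure \<Rightarrow> complex set \<Rightarrow> (complex \<Rightarrow> real) \<Rightarrow> real" where
  "charge_integral nuP nuN A f = (LINT z:A|nuP. f z) - (LINT z:A|nuN. f z)"

definition setfun_variation :: "(complex set \<Rightarrow> real) \<Rightarrow> complex set \<Rightarrow> ennreal" where
  "setfun_variation lam B =
     (SUP P \<in> {P. finite P \<and> disjoint P \<and> P \<subseteq> sets borel \<and> \<Union>P \<subseteq> B}.
        \<Sum>A\<in>P. ennreal \<bar>lam A\<bar>)"

definition setfun_rad :: "(complex set \<Rightarrow> real) \<Rightarrow> real \<Rightarrow> ennreal" where
  "setfun_rad lam r = setfun_variation lam (cball 0 r)"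

definition setfun_is_charge :: "(complex set \<Rightarrow> real) \<Rightarrow> bool" where
  "setfun_is_charge lam \<longleftrightarrow>
     (\<forall>A :: nat \<Rightarrow> complex set. range A \<subseteq> sets borel \<longrightarrow> disjoint_family A \<longrightarrow>
        bounded (\<Union>n. A n) \<longrightarrow> (\<lambda>n. lam (A n)) sums lam (\<Union>n. A n))"

definition finite_type :: "(real \<Rightarrow> ennreal) \<Rightarrow> real \<Rightarrow> bool" where
  "finite_type rad p \<longleftrightarrow> Limsup at_top (\<lambda>r. rad r / ennreal (r powr p)) < \<infinity>"

definition angle :: "real \<Rightarrow> real \<Rightarrow> complex set" where
  "angle \<alpha> \<beta> = {complex_of_real r * cis \<theta> | r \<theta>. 0 < r \<and> \<alpha> < \<theta> \<and> \<theta> < \<beta>}"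

text \<open>(z e^{-i\<alpha>})^s = r^s e^{is(\<theta>-\<alpha>)} for z = r e^{i\<theta>} with \<theta> - \<alpha> \<in> [0, 2\<pi>);
  for z in \<angle>(\<alpha>,\<beta>) with \<beta> \<le> \<alpha> + 2\<pi> this is the paper's branch.\<close>
definition angle_pow :: "real \<Rightarrow> real \<Rightarrow> complex \<Rightarrow> complex" where
  "angle_pow \<alpha> s z = complex_of_real (cmod z powr s) * cis (s * Arg2pi (z * cis (- \<alpha>)))"

definition tilde_z :: "real \<Rightarrow> real \<Rightarrow> complex \<Rightarrow> complex" where
  "tilde_z \<alpha> \<beta> z = angle_pow \<alpha> (pi / (\<beta> - \<alpha>)) z"

definition tilde_set :: "real \<Rightarrow> real \<Rightarrow> complex set \<Rightarrow> real set" where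
  "tilde_set \<alpha> \<beta> B =
     {t. 0 \<le> t \<and> complex_of_real (t powr ((\<beta> - \<alpha>) / pi)) * cis \<alpha> \<in> B} \<union>
     {t. t \<le> 0 \<and> complex_of_real (\<bar>t\<bar> powr ((\<beta> - \<alpha>) / pi)) * cis \<beta> \<in> B}"

definition Omega :: "real \<Rightarrow> real \<Rightarrow> nat \<Rightarrow> complex \<Rightarrow> complex set \<Rightarrow> real" where
  "Omega \<alpha> \<beta> q z B =
     (1 / pi) * (LINT t:tilde_set \<alpha> \<beta> B|lborel. Im (1 / (complex_of_real t - tilde_z \<alpha> \<beta> z)))
   + (1 / pi) * (\<Sum>k=1..q. Im (inverse (tilde_z \<alpha> \<beta> z ^ k)) *
                   (LINT t:tilde_set \<alpha> \<beta> B|lborel. t ^ (k - 1)))"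

definition balayage ::
  "real \<Rightarrow> real \<Rightarrow> nat \<Rightarrow> complex measure \<Rightarrow> complex measure \<Rightarrow> complex set \<Rightarrow> real" where
  "balayage \<alpha> \<beta> q nuP nuN B =
     charge_integral nuP nuN (angle \<alpha> \<beta>) (\<lambda>z. Omega \<alpha> \<beta> q z B)
     + (measure nuP (B - angle \<alpha> \<beta>) - measure nuN (B - angle \<alpha> \<beta>))"

definition balayage_exists ::
  "real \<Rightarrow> real \<Rightarrow> nat \<Rightarrow> complex measure \<Rightarrow> complex measure \<Rightarrow> bool" where
  "balayage_exists \<alpha> \<beta> q nuP nuN \<longleftrightarrow>
     (\<forall>B\<in>sets borel. bounded B \<longrightarrow>
        set_integrable nuP (angle \<alpha> \<beta>) (\<lambda>z. Omega \<alpha> \<beta> q z B) \<and>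
        set_integrable nuN (angle \<alpha> \<beta>) (\<lambda>z. Omega \<alpha> \<beta> q z B)) \<and>
     setfun_is_charge (balayage \<alpha> \<beta> q nuP nuN)"

end

theory Submission
  imports Defs
begin

text \<open>Put \<open>a = \<pi> / (\<beta> - \<alpha>)\<close> and \<open>w = tilde_z z\<close>, so that \<open>|w| = |z|\<^sup>a\<close>. The density of the harmonic charge of
  genus \<open>q\<close> at \<open>t\<close> is, up to \<open>1/\<pi>\<close>, the imaginary part of \<open>t\<^sup>q / (w\<^sup>q (t - w))\<close>, which is at most
  \<open>2 |t|\<^sup>q / |w|\<^sup>q\<^sup>+\<^sup>1\<close> for \<open>|w| \<ge> 2|t|\<close>. To bound the variation on the disc of radius \<open>r\<close>, split the sweep at
  \<open>|w| = 2r\<^sup>a\<close>. The far part is \<open>O(r\<^sup>p)\<close> because \<open>a(q + 1) > p\<close>. In the near part the Poisson kernel has total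
  mass at most one, which leaves the monomials \<open>t\<^sup>k\<^sup>-\<^sup>1\<close> with coefficients given by the integral of
  \<open>Im w\<^sup>-\<^sup>k\<close> over the near part. These contribute \<open>O(r\<^sup>p)\<close> whenever \<open>ak < p\<close>; for \<open>k = q\<close>, moving the cut
  from \<open>|w| = 2r\<^sup>a\<close> to \<open>|z| = r\<close> costs only \<open>O(r\<^sup>p)\<close> and leaves the extra term. The integrals of powers of
  \<open>|z|\<close> are estimated over dyadic shells.\<close>

subsection \<open>Dyadic estimates for measures of power growth\<close>

lemma set_integral_le_of_nn_integral:
  fixes f :: "'a \<Rightarrow> real"
  assumes [measurable]: "f \<in> borel_measurable M" "A \<in> sets M"
    and nonneg: "\<And>x. x \<in> A \<Longrightarrow> 0 \<le> f x"
    and le: "(\<integral>\<^sup>+x. ennreal (indicator A x * f x) \<partial>M) \<le> ennreal T" and T: "0 \<le> T"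
  shows "set_integrable M A f" "(LINT x:A|M. f x) \<le> T"
proof -
  have nn: "0 \<le> indicator A x * f x" for x
    using nonneg by (auto simp: indicator_def)
  show int: "set_integrable M A f"
    unfolding set_integrable_def real_scaleR_def
    using nn le_less_trans[OF le] by (intro integrableI_nonneg) (auto simp: less_top)
  have "ennreal (LINT x:A|M. f x) = (\<integral>\<^sup>+x. ennreal (indicator A x * f x) \<partial>M)"
    unfolding set_lebesgue_integral_def real_scaleR_def
    using nn int by (intro nn_integral_eq_integral[symmetric]) (auto simp: set_integrable_def)
  with le show "(LINT x:A|M. f x) \<le> T"
    using ennreal_le_iff[OF T] by metis
qed

text \<open>Pointwise \<open>f\<close> is at most the sum of \<open>b j\<close> times the indicator
  of \<open>S j\<close>, so monotone convergence bounds the integral by the sum of the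
  \<open>b j * m j\<close>. Overlaps only increase that majorant, so closed shells sharing their
  boundaries are allowed.\<close>

lemma set_integral_le_shells:
  fixes f :: "'a \<Rightarrow> real"
  assumes [measurable]: "f \<in> borel_measurable M" "A \<in> sets M" "\<And>j. S j \<in> sets M"
    and nonneg: "\<And>x. x \<in> A \<Longrightarrow> 0 \<le> f x"
    and cover: "\<And>x. x \<in> A \<Longrightarrow> f x = 0 \<or> (\<exists>j. x \<in> S j)"
    and f_le: "\<And>j x. x \<in> S j \<Longrightarrow> f x \<le> b j"
    and em: "\<And>j. emeasure M (S j) \<le> ennreal (m j)"
    and bm: "\<And>j. 0 \<le> b j" "\<And>j. 0 \<le> m j"
    and sums: "(\<lambda>j. b j * m j) sums T"
  shows "set_integrable M A f" "(LINT x:A|M. f x) \<le> T"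
proof -
  have T: "0 \<le> T"
    using sums_le[OF _ sums_zero sums] bm by simp
  have "(\<integral>\<^sup>+x. ennreal (indicator A x * f x) \<partial>M) \<le> (\<integral>\<^sup>+x. (\<Sum>j. ennreal (b j) * indicator (S j) x) \<partial>M)"
  proof (intro nn_integral_mono)
    fix x
    show "ennreal (indicator A x * f x) \<le> (\<Sum>j. ennreal (b j) * indicator (S j) x)"
    proof (cases "x \<in> A \<and> f x \<noteq> 0")
      case True
      then obtain j where j: "x \<in> S j"
        using cover by blast
      have "ennreal (indicator A x * f x) \<le> ennreal (b j) * indicator (S j) x"
        using True j f_le[OF j] by (simp add: ennreal_leI)
      also have "\<dots> = (\<Sum>i\<in>{j}. ennreal (b i) * indicator (S i) x)"
        using j by simp
      also have "\<dots> \<le> (\<Sum>i. ennreal (b i) * indicator (S i) x)"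
        by (intro sum_le_suminf) auto
      finally show ?thesis .
    qed (auto simp: indicator_def)
  qed
  also have "\<dots> = (\<Sum>j. ennreal (b j) * emeasure M (S j))"
    by (subst nn_integral_suminf) (auto simp: nn_integral_cmult_indicator)
  also have "\<dots> \<le> (\<Sum>j. ennreal (b j * m j))"
    using em bm by (intro suminf_le) (auto simp: ennreal_mult intro!: mult_left_mono)
  also have "\<dots> = ennreal T"
    using sums bm by (subst suminf_ennreal_eq[OF _ sums]) auto
  finally have *: "(\<integral>\<^sup>+x. ennreal (indicator A x * f x) \<partial>M) \<le> ennreal T" .
  show "set_integrable M A f" "(LINT x:A|M. f x) \<le> T"
    using set_integral_le_of_nn_integral[OF _ _ nonneg * T] by auto
qed

text \<open>Halve \<open>r\<close> until it first drops to \<open>x\<close> or below. The cap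
  \<open>N\<close> on the number of halvings is what later produces a logarithm.\<close>

lemma dyadic_shell_down:
  fixes x r :: real
  assumes "0 < x" "x < r" "r \<le> x * 2 ^ N"
  shows "\<exists>j<N. r / 2 ^ Suc j \<le> x \<and> x \<le> r / 2 ^ j"
proof -
  define n where "n = (LEAST n. r \<le> x * 2 ^ n)"
  have n: "r \<le> x * 2 ^ n" "n \<le> N"
    using assms(3) unfolding n_def by (auto intro: LeastI Least_le)
  then obtain j where j: "n = Suc j"
    using assms(2) by (cases n) auto
  then have "\<not> r \<le> x * 2 ^ j"
    unfolding n_def by (metis lessI not_less_Least)
  with n j show ?thesis
    by (intro exI[of _ j]) (auto simp: field_simps)
qed

lemma dyadic_shell_up:
  fixes x r :: real
  assumes "0 < r" "r \<le> x"
  shows "\<exists>j. r * 2 ^ j \<le> x \<and> x \<le> r * 2 ^ Suc j"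
proof -
  obtain N :: nat where N: "x / r < 2 ^ N"
    using real_arch_pow[of 2 "x / r"] by auto
  define n where "n = (LEAST n. x < r * 2 ^ n)"
  have n: "x < r * 2 ^ n"
    unfolding n_def by (rule LeastI[of _ N]) (use N assms in \<open>simp add: field_simps\<close>)
  then obtain j where j: "n = Suc j"
    using assms(2) by (cases n) auto
  then have "\<not> x < r * 2 ^ j"
    unfolding n_def by (metis lessI not_less_Least)
  with n j show ?thesis
    by (intro exI[of _ j]) auto
qed

lemma powr_dyadic:
  fixes r :: real
  assumes "0 < r"
  shows "(r * 2 ^ j) powr u = r powr u * (2 powr u) ^ j"
    and "(r / 2 ^ j) powr u = r powr u * (2 powr (- u)) ^ j"
proof -
  have e: "(2 ^ j) powr u = (2 powr u) ^ j" for u :: real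
    by (simp add: powr_powr powr_realpow[symmetric] mult.commute)
  show "(r * 2 ^ j) powr u = r powr u * (2 powr u) ^ j"
    using assms by (simp add: powr_mult e)
  have "(r / 2 ^ j) powr u = r powr u / (2 powr u) ^ j"
    using assms by (simp add: powr_divide e)
  then show "(r / 2 ^ j) powr u = r powr u * (2 powr (- u)) ^ j"
    by (simp add: powr_minus divide_inverse power_inverse)
qed

text \<open>Largest value of the integrand times the mass bound on one shell. The result is
  geometric in \<open>j\<close>: outward shells sum for \<open>s > p\<close>, inward shells for
  \<open>s < p\<close>, and at \<open>s = p\<close> all shells weigh the same.\<close>

lemma shell_product:
  fixes r K s p :: real
  assumes r: "0 < r"
  shows "(r * 2 ^ j) powr (- s) * (K * (r * 2 ^ Suc j) powr p)
           = K * 2 powr p * r powr (p - s) * (2 powr (p - s)) ^ j"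
    and "(r / 2 ^ Suc j) powr (- s) * (K * (r / 2 ^ j) powr p)
           = K * 2 powr s * r powr (p - s) * (2 powr (s - p)) ^ j"
proof -
  have e: "x powr (u - v) = x powr u * x powr (- v)" for x u v :: real
    by (simp add: powr_add[symmetric])
  show "(r * 2 ^ j) powr (- s) * (K * (r * 2 ^ Suc j) powr p)
           = K * 2 powr p * r powr (p - s) * (2 powr (p - s)) ^ j"
    unfolding powr_dyadic(1)[OF r] e power_mult_distrib by (simp add: mult_ac)
  show "(r / 2 ^ Suc j) powr (- s) * (K * (r / 2 ^ j) powr p)
           = K * 2 powr s * r powr (p - s) * (2 powr (s - p)) ^ j"
    unfolding powr_dyadic(2)[OF r] e power_mult_distrib by (simp add: mult_ac)
qed

text \<open>The bound is demanded for every radius, not only near infinity. Finite type supplies it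
  because the mass near the origin vanishes.\<close>

locale growth_measure =
  fixes M :: "complex measure" and K p r0 :: real
  assumes sets_M [measurable_cong, simp]: "sets M = sets borel"
    and p_pos: "0 < p" and K_nonneg: "0 \<le> K" and r0_pos: "0 < r0"
    and null: "emeasure M (ball 0 r0) = 0"
    and growth: "0 \<le> r \<Longrightarrow> emeasure M (cball 0 r) \<le> ennreal (K * r powr p)"
begin

lemma emeasure_subset_cball:
  assumes "0 \<le> r" "A \<subseteq> cball 0 r"
  shows "emeasure M A \<le> ennreal (K * r powr p)"
  using emeasure_mono[OF assms(2), of M] growth[OF assms(1)] by auto

lemma tail_integral:
  assumes s: "p < s" and r: "0 < r"
  shows "set_integrable M {z. r \<le> cmod z} (\<lambda>z. cmod z powr (- s))"
    and "(LINT z:{z. r \<le> cmod z}|M. cmod z powr (- s))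
           \<le> K * 2 powr p / (1 - 2 powr (p - s)) * r powr (p - s)"
proof -
  have s0: "0 < s" using s p_pos by simp
  have lt1: "2 powr (p - s) < (1::real)" using s powr_less_cancel_iff[of 2 _ 0] by simp
  have "(\<lambda>j. K * 2 powr p * r powr (p - s) * (2 powr (p - s)) ^ j)
          sums (K * 2 powr p * r powr (p - s) * (1 / (1 - 2 powr (p - s))))"
    using lt1 by (intro sums_mult geometric_sums) auto
  then have sums: "(\<lambda>j. (r * 2 ^ j) powr (- s) * (K * (r * 2 ^ Suc j) powr p))
     sums (K * 2 powr p / (1 - 2 powr (p - s)) * r powr (p - s))"
    unfolding shell_product[OF r] by (simp add: mult_ac)
  let ?S = "\<lambda>j. {z :: complex. r * 2 ^ j \<le> cmod z \<and> cmod z \<le> r * 2 ^ Suc j}"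
  have f_le: "cmod z powr (- s) \<le> (r * 2 ^ j) powr (- s)" if "z \<in> ?S j" for j z
    using that r s0 by (intro powr_mono2') auto
  have em: "emeasure M (?S j) \<le> ennreal (K * (r * 2 ^ Suc j) powr p)" for j
    using r by (intro emeasure_subset_cball) auto
  have cover: "cmod z powr (- s) = 0 \<or> (\<exists>j. z \<in> ?S j)" if "z \<in> {z. r \<le> cmod z}" for z
    using dyadic_shell_up[OF r, of "cmod z"] that by auto
  show "set_integrable M {z. r \<le> cmod z} (\<lambda>z. cmod z powr (- s))"
    "(LINT z:{z. r \<le> cmod z}|M. cmod z powr (- s))
           \<le> K * 2 powr p / (1 - 2 powr (p - s)) * r powr (p - s)"
    by (rule set_integral_le_shells[where S = ?S and m = "\<lambda>j. K * (r * 2 ^ Suc j) powr p"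
        and b = "\<lambda>j. (r * 2 ^ j) powr (- s)", OF _ _ _ _ cover f_le em _ _ sums]; use K_nonneg in simp)+
qed

lemma inner_integral:
  assumes s: "0 \<le> s" "s < p" and r: "0 < r"
  shows "set_integrable M (ball 0 r) (\<lambda>z. cmod z powr (- s))"
    and "(LINT z:ball 0 r|M. cmod z powr (- s))
           \<le> K * 2 powr s / (1 - 2 powr (s - p)) * r powr (p - s)"
proof -
  have lt1: "2 powr (s - p) < (1::real)" using s powr_less_cancel_iff[of 2 _ 0] by simp
  have "(\<lambda>j. K * 2 powr s * r powr (p - s) * (2 powr (s - p)) ^ j)
          sums (K * 2 powr s * r powr (p - s) * (1 / (1 - 2 powr (s - p))))"
    using lt1 by (intro sums_mult geometric_sums) auto
  then have sums: "(\<lambda>j. (r / 2 ^ Suc j) powr (- s) * (K * (r / 2 ^ j) powr p))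
     sums (K * 2 powr s / (1 - 2 powr (s - p)) * r powr (p - s))"
    unfolding shell_product[OF r] by (simp add: mult_ac)
  let ?S = "\<lambda>j. {z :: complex. r / 2 ^ Suc j \<le> cmod z \<and> cmod z \<le> r / 2 ^ j}"
  have f_le: "cmod z powr (- s) \<le> (r / 2 ^ Suc j) powr (- s)" if "z \<in> ?S j" for j z
    using that r s by (intro powr_mono2') auto
  have em: "emeasure M (?S j) \<le> ennreal (K * (r / 2 ^ j) powr p)" for j
    using r by (intro emeasure_subset_cball) auto
  \<comment> \<open>The origin lies in no shell, but the integrand is \<open>0\<close> there because
    \<open>0 powr x = 0\<close>.\<close>
  have cover: "cmod z powr (- s) = 0 \<or> (\<exists>j. z \<in> ?S j)" if "z \<in> ball 0 r" for z
  proof (cases "z = 0")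
    case False
    obtain N :: nat where "r / cmod z < 2 ^ N"
      using real_arch_pow[of 2 "r / cmod z"] by auto
    then have "r \<le> cmod z * 2 ^ N"
      using False by (simp add: field_simps)
    then show ?thesis
      using dyadic_shell_down[of "cmod z" r N] that False by auto
  qed simp
  show "set_integrable M (ball 0 r) (\<lambda>z. cmod z powr (- s))"
    "(LINT z:ball 0 r|M. cmod z powr (- s))
           \<le> K * 2 powr s / (1 - 2 powr (s - p)) * r powr (p - s)"
    by (rule set_integral_le_shells[where S = ?S and m = "\<lambda>j. K * (r / 2 ^ j) powr p"
        and b = "\<lambda>j. (r / 2 ^ Suc j) powr (- s)", OF _ _ _ _ cover f_le em _ _ sums]; use K_nonneg in simp)+
qed

text \<open>Unlike the two preceding estimates this one includes the critical exponent
  \<open>s = p\<close>. No shell contributes more than a fixed multiple of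
  \<open>r powr (p - s)\<close>, and about \<open>log 2 (r / r0)\<close> shells reach from
  \<open>r\<close> down to \<open>r0\<close>.\<close>

lemma annulus_integral:
  assumes s: "0 \<le> s" "s \<le> p" and r: "r0 \<le> r"
  shows "(LINT z:ball 0 r - ball 0 r0|M. cmod z powr (- s))
           \<le> K * 2 powr s * r powr (p - s) * (1 + log 2 (r / r0))"
proof -
  have r': "0 < r" using r r0_pos by simp
  define N where "N = nat \<lceil>log 2 (r / r0)\<rceil>"
  have log0: "0 \<le> log 2 (r / r0)" using r r0_pos by simp
  have N: "real N \<le> 1 + log 2 (r / r0)" "log 2 (r / r0) \<le> real N"
    using log0 unfolding N_def by linarith+
  have "r / r0 \<le> 2 powr real N"
    using N(2) r' r0_pos by (simp add: log_le_iff)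
  then have rN: "r \<le> r0 * 2 ^ N"
    using r0_pos by (simp add: powr_realpow field_simps)
  \<comment> \<open>Shells beyond the \<open>N\<close>-th are replaced by empty sets of mass bound
    \<open>0\<close>, so that the finite sum fits the lemma on infinitely many shells.\<close>
  let ?S = "\<lambda>j. if j < N then {z :: complex. r / 2 ^ Suc j \<le> cmod z \<and> cmod z \<le> r / 2 ^ j} else {}"
  let ?m = "\<lambda>j. if j < N then K * (r / 2 ^ j) powr p else 0"
  let ?c = "K * 2 powr s * r powr (p - s)"
  have sums: "(\<lambda>j. (r / 2 ^ Suc j) powr (- s) * ?m j) sums (\<Sum>j<N. (r / 2 ^ Suc j) powr (- s) * ?m j)"
    by (rule sums_finite) auto
  have f_le: "cmod z powr (- s) \<le> (r / 2 ^ Suc j) powr (- s)" if "z \<in> ?S j" for j z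
    using that r' s by (intro powr_mono2') (auto split: if_splits)
  have em: "emeasure M (?S j) \<le> ennreal (?m j)" for j
    using r' by (auto intro!: emeasure_subset_cball)
  have cover: "cmod z powr (- s) = 0 \<or> (\<exists>j. z \<in> ?S j)" if "z \<in> ball 0 r - ball 0 r0" for z
  proof -
    have z: "r0 \<le> cmod z" "cmod z < r" using that by auto
    then have "r0 * 2 ^ N \<le> cmod z * 2 ^ N"
      by (intro mult_right_mono) auto
    then have "r \<le> cmod z * 2 ^ N" "0 < cmod z"
      using rN z r0_pos by linarith+
    then obtain j where "j < N" "r / 2 ^ Suc j \<le> cmod z" "cmod z \<le> r / 2 ^ j"
      using dyadic_shell_down z(2) by blast
    then have "z \<in> ?S j" by simp
    then show ?thesis by blast
  qed
  have "(LINT z:ball 0 r - ball 0 r0|M. cmod z powr (- s)) \<le> (\<Sum>j<N. (r / 2 ^ Suc j) powr (- s) * ?m j)"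
  proof (rule set_integral_le_shells(2)[where S = ?S and m = ?m and b = "\<lambda>j. (r / 2 ^ Suc j) powr (- s)"])
    show "?S j \<in> sets M" for j by simp
    show "cmod z powr (- s) = 0 \<or> (\<exists>j. z \<in> ?S j)" if "z \<in> ball 0 r - ball 0 r0" for z
      using that by (rule cover)
    show "cmod z powr (- s) \<le> (r / 2 ^ Suc j) powr (- s)" if "z \<in> ?S j" for j z
      using that by (rule f_le)
    show "emeasure M (?S j) \<le> ennreal (?m j)" for j
      by (rule em)
    show "0 \<le> ?m j" for j
      using K_nonneg by simp
  qed (use sums in simp_all)
  also have "\<dots> \<le> (\<Sum>j<N. ?c)"
  proof (rule sum_mono)
    fix j assume "j \<in> {..<N}"
    have "2 powr (s - p) \<le> (1 :: real)" using s powr_le_cancel_iff[of 2 _ 0] by simp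
    then have "?c * (2 powr (s - p)) ^ j \<le> ?c * 1"
      using K_nonneg by (intro mult_left_mono power_le_one) auto
    moreover have "?c * (2 powr (s - p)) ^ j = (r / 2 ^ Suc j) powr (- s) * (K * (r / 2 ^ j) powr p)"
      by (rule shell_product(2)[OF r', symmetric])
    ultimately show "(r / 2 ^ Suc j) powr (- s) * ?m j \<le> ?c"
      using \<open>j \<in> {..<N}\<close> by simp
  qed
  also have "\<dots> = ?c * real N" by simp
  also have "\<dots> \<le> ?c * (1 + log 2 (r / r0))"
    using K_nonneg N by (intro mult_left_mono) auto
  finally show ?thesis .
qed

lemma AE_ge_r0: "AE z in M. r0 \<le> cmod z"
proof (rule AE_I[of _ _ "ball 0 r0"])
  show "{z \<in> space M. \<not> r0 \<le> cmod z} \<subseteq> ball 0 r0" by auto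
qed (auto simp: null)

text \<open>The bound on \<open>f\<close> is required only off the null disc
  \<open>ball 0 r0\<close>, which admits negative powers of \<open>z\<close>.\<close>

lemma integrable_bounded_on_ball:
  fixes f :: "complex \<Rightarrow> real"
  assumes [measurable]: "f \<in> borel_measurable borel" "A \<in> sets borel" 
    and A: "A \<subseteq> cball 0 r" and bd: "\<And>z. z \<in> A \<Longrightarrow> r0 \<le> cmod z \<Longrightarrow> \<bar>f z\<bar> \<le> b"
  shows "set_integrable M A f"
  unfolding set_integrable_def
proof (rule integrableI_bounded_set[where A = A and B = b])
  have "emeasure M A \<le> ennreal (K * \<bar>r\<bar> powr p)"
    by (rule emeasure_subset_cball) (use A in auto)
  then show "emeasure M A < \<infinity>"
    using le_less_trans by fastforce
  show "AE z in M. z \<in> A \<longrightarrow> norm (indicator A z *\<^sub>R f z) \<le> b"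
    using AE_ge_r0 by eventually_elim (auto intro: bd)
qed auto

end

subsection \<open>The harmonic charge of genus \<open>q\<close>\<close>

text \<open>This bounds the variation of an indefinite integral. The pieces form an indexed family,
  not a set of sets, because different plane sets may have the same trace on the boundary, for
  instance the empty one.\<close>

lemma sum_abs_set_integral_le:
  fixes g :: "'a \<Rightarrow> real"
  assumes fin: "finite P" and disj: "disjoint_family_on S P"
    and S: "\<And>A. A \<in> P \<Longrightarrow> S A \<in> sets M" "\<And>A. A \<in> P \<Longrightarrow> S A \<subseteq> X"
    and X: "X \<in> sets M" and int: "set_integrable M X g"
  shows "(\<Sum>A\<in>P. \<bar>LINT t:S A|M. g t\<bar>) \<le> (LINT t:X|M. \<bar>g t\<bar>)"
proof -
  have intA: "set_integrable M (S A) (\<lambda>t. \<bar>g t\<bar>)" if "A \<in> P" for A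
    using set_integrable_subset[OF set_integrable_abs[OF int] S(1)[OF that] S(2)[OF that]] .
  have sub: "(\<Union>A\<in>P. S A) \<subseteq> X" using S by auto
  have mS: "(\<Union>A\<in>P. S A) \<in> sets M" using S fin by auto
  have "(\<Sum>A\<in>P. \<bar>LINT t:S A|M. g t\<bar>) \<le> (\<Sum>A\<in>P. LINT t:S A|M. \<bar>g t\<bar>)"
  proof (rule sum_mono)
    fix A assume A: "A \<in> P"
    have "set_integrable M (S A) g"
      using set_integrable_subset[OF int S(1)[OF A] S(2)[OF A]] .
    then show "\<bar>LINT t:S A|M. g t\<bar> \<le> (LINT t:S A|M. \<bar>g t\<bar>)"
      using set_integral_norm_bound[of M "S A" g] by simp
  qed
  also have "\<dots> = (LINT t:(\<Union>A\<in>P. S A)|M. \<bar>g t\<bar>)"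
    using set_integral_finite_Union[OF fin disj intA S(1)] by simp
  also have "\<dots> \<le> (LINT t:X|M. \<bar>g t\<bar>)"
  proof -
    have "set_integrable M (\<Union>A\<in>P. S A) (\<lambda>t. \<bar>g t\<bar>)"
      using set_integrable_subset[OF set_integrable_abs[OF int] mS sub] .
    then show ?thesis
      unfolding set_lebesgue_integral_def set_integrable_def
      by (rule integral_mono) (use set_integrable_abs[OF int] sub in \<open>auto simp: set_integrable_def indicator_def\<close>)
  qed
  finally show ?thesis .
qed

section \<open>Measurability and modulus of the branch \<open>angle_pow\<close>\<close>

lemma borel_measurable_Arg2pi [measurable]: "Arg2pi \<in> borel_measurable borel"
  by (subst borel_measurable_iff_le) (auto intro!: borel_closed closed_Arg2pi2pi_le)

lemma borel_measurable_cis [measurable]: "cis \<in> borel_measurable borel"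
  by (intro borel_measurable_continuous_onI continuous_intros)

lemma borel_measurable_angle_pow [measurable]: "angle_pow \<alpha> s \<in> borel_measurable borel"
  unfolding angle_pow_def by measurable

lemma borel_measurable_tilde_z [measurable]: "tilde_z \<alpha> \<beta> \<in> borel_measurable borel"
  unfolding tilde_z_def by measurable

lemma cmod_angle_pow: "cmod (angle_pow \<alpha> s z) = cmod z powr s"
  by (simp add: angle_pow_def norm_mult)

lemma powr_power_nat:
  fixes x s :: real
  assumes "0 < x"
  shows "(x powr s) ^ k = x powr (s * real k)"
  using assms by (simp add: powr_powr flip: powr_realpow)

text \<open>De Moivre: an integer exponent does not change the branch. The origin is excluded
  because of \<open>k = 0\<close>, where the left side is \<open>1\<close> while
  \<open>0 powr 0 = 0\<close>.\<close>

lemma angle_pow_power: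
  assumes "z \<noteq> 0"
  shows "angle_pow \<alpha> s z ^ k = angle_pow \<alpha> (s * real k) z"
proof -
  have "(cmod z powr s) ^ k = cmod z powr (s * real k)"
    using assms by (simp add: powr_power_nat)
  then show ?thesis
    unfolding angle_pow_def power_mult_distrib Complex.DeMoivre of_real_power[symmetric]
    by (simp add: mult_ac)
qed

text \<open>The polynomial cancels the first \<open>q\<close> terms of the Taylor expansion of
  \<open>1 / (t - w)\<close> at \<open>t = 0\<close>; the decay in \<open>w\<close> improves by one
  order with each term.\<close>

definition genus_kernel :: "nat \<Rightarrow> complex \<Rightarrow> real \<Rightarrow> real" where
  "genus_kernel q w t =
     Im (1 / (complex_of_real t - w)) + (\<Sum>k=1..q. Im (inverse (w ^ k)) * t ^ (k - 1))"

lemma genus_kernel_eq: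
  assumes "w \<noteq> 0" "complex_of_real t \<noteq> w"
  shows "genus_kernel q w t = Im (complex_of_real t ^ q / (w ^ q * (complex_of_real t - w)))"
proof -
  have "1 / (complex_of_real t - w) + (\<Sum>k=1..q. complex_of_real (t ^ (k - 1)) * inverse (w ^ k))
      = complex_of_real t ^ q / (w ^ q * (complex_of_real t - w))"
  proof (induction q)
    case (Suc q)
    \<comment> \<open>Adding one more monomial turns the remainder of genus \<open>q\<close> into
      that of genus \<open>q + 1\<close>, since
      \<open>1 / (t - w) + 1 / w = t / (w * (t - w))\<close>.\<close>
    have "complex_of_real t ^ q / (w ^ q * (complex_of_real t - w)) + complex_of_real t ^ q * inverse (w ^ Suc q)
        = complex_of_real t ^ Suc q / (w ^ Suc q * (complex_of_real t - w))"
      using assms by (simp add: divide_simps) (simp add: algebra_simps)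
    with Suc show ?case
      by (simp add: add.assoc[symmetric] del: power_Suc)
  qed simp
  then have "Im (complex_of_real t ^ q / (w ^ q * (complex_of_real t - w)))
      = Im (1 / (complex_of_real t - w)) + (\<Sum>k=1..q. Im (complex_of_real (t ^ (k - 1)) * inverse (w ^ k)))"
    by (metis Im_sum plus_complex.simps(2))
  then show ?thesis
    unfolding genus_kernel_def by (simp add: mult.commute)
qed

lemma genus_kernel_far:
  assumes "0 < R" "\<bar>t\<bar> \<le> R" "2 * R \<le> cmod w"
  shows "\<bar>genus_kernel q w t\<bar> \<le> 2 * R ^ q / cmod w ^ Suc q"
proof -
  have "cmod w - \<bar>t\<bar> \<le> cmod (complex_of_real t - w)"
    using norm_triangle_ineq2[of w "complex_of_real t"] by (simp add: norm_minus_commute)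
  \<comment> \<open>As \<open>\<bar>t\<bar>\<close> is at most half of \<open>cmod w\<close>, the
    pole stays at distance at least \<open>cmod w / 2\<close>; this is the source of the factor
    \<open>2\<close>.\<close>
  then have d: "cmod w / 2 \<le> cmod (complex_of_real t - w)" and w: "0 < cmod w"
    using assms by linarith+
  then have ne: "w \<noteq> 0" "complex_of_real t \<noteq> w" by auto
  have "\<bar>genus_kernel q w t\<bar> \<le> cmod (complex_of_real t ^ q / (w ^ q * (complex_of_real t - w)))"
    unfolding genus_kernel_eq[OF ne] by (rule abs_Im_le_cmod)
  also have "\<dots> = \<bar>t\<bar> ^ q / (cmod w ^ q * cmod (complex_of_real t - w))"
    by (simp add: norm_divide norm_mult norm_power)
  also have "\<dots> \<le> R ^ q / (cmod w ^ q * (cmod w / 2))"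
    using assms d w by (intro frac_le mult_left_mono power_mono mult_pos_pos) auto
  also have "\<dots> = 2 * R ^ q / cmod w ^ Suc q"
    by (simp add: field_simps)
  finally show ?thesis .
qed

section \<open>The Poisson kernel of the upper half-plane\<close>

lemma continuous_on_resolvent:
  assumes "0 < Im w"
  shows "continuous_on X (\<lambda>t. Im (1 / (complex_of_real t - w)))"
proof -
  have "complex_of_real t - w \<noteq> 0" for t
    using assms by (auto simp: complex_eq_iff)
  then show ?thesis
    by (intro continuous_intros) auto
qed

lemma Im_resolvent: "Im (1 / (complex_of_real t - w)) = Im w / ((t - Re w)\<^sup>2 + (Im w)\<^sup>2)"
  by (simp add: Im_divide)

text \<open>The kernel is the derivative of \<open>arctan ((t - Re w) / Im w)\<close>, whose total
  oscillation is at most \<open>pi\<close>, uniformly in \<open>w\<close>.\<close>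

lemma poisson_integral_le:
  assumes "0 < Im w" "0 \<le> T"
  shows "(LINT t:{-T..T}|lborel. Im (1 / (complex_of_real t - w))) \<le> pi"
proof -
  let ?F = "\<lambda>t. arctan ((t - Re w) / Im w)"
  have deriv: "(?F has_real_derivative Im (1 / (complex_of_real t - w))) (at t within {-T..T})" for t
  proof -
    have "(?F has_real_derivative (1 / Im w) * inverse (1 + ((t - Re w) / Im w)\<^sup>2)) (at t within {-T..T})"
      using assms by (auto intro!: derivative_eq_intros simp: divide_simps)
    also have "(1 / Im w) * inverse (1 + ((t - Re w) / Im w)\<^sup>2) = Im (1 / (complex_of_real t - w))"
      unfolding Im_resolvent using assms
      by (simp add: divide_simps sum_power2_eq_zero_iff) (simp add: power2_eq_square algebra_simps)
    finally show ?thesis .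
  qed
  have "(LINT t:{-T..T}|lborel. Im (1 / (complex_of_real t - w))) = ?F T - ?F (-T)"
    unfolding set_lebesgue_integral_def
    using assms deriv
    by (intro integral_FTC_atLeastAtMost continuous_on_resolvent)
       (auto simp: has_real_derivative_iff_has_vector_derivative)
  also have "\<dots> \<le> pi"
    using arctan_bounded[of "(T - Re w) / Im w"] arctan_bounded[of "(-T - Re w) / Im w"] by linarith
  finally show ?thesis .
qed

lemma continuous_on_genus_kernel:
  assumes "0 < Im w"
  shows "continuous_on X (genus_kernel q w)"
  unfolding genus_kernel_def using assms by (intro continuous_intros continuous_on_resolvent)

section \<open>The angle, its power map onto the half-plane and its two-sided boundary\<close>

locale sector =
  fixes \<alpha> \<beta> :: real
  assumes less: "\<alpha> < \<beta>" and aperture: "\<beta> \<le> \<alpha> + 2 * pi"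
begin

definition a :: real where "a = pi / (\<beta> - \<alpha>)"

lemma a_pos: "0 < a"
  using less by (simp add: a_def)

lemma tilde_z_eq: "tilde_z \<alpha> \<beta> = angle_pow \<alpha> a"
  by (simp add: tilde_z_def a_def fun_eq_iff)

text \<open>Since the aperture is at most \<open>2 * pi\<close>, the number
  \<open>\<theta> - \<alpha>\<close> lies strictly between \<open>0\<close> and
  \<open>2 * pi\<close> and is recovered by \<open>Arg2pi\<close>. This makes the angle a Borel set
  and identifies the branch in \<open>tilde_z\<close>.\<close>

lemma angle_eq:
  "angle \<alpha> \<beta> = {z. z \<noteq> 0 \<and> 0 < Arg2pi (z * cis (- \<alpha>)) \<and> Arg2pi (z * cis (- \<alpha>)) < \<beta> - \<alpha>}"
proof (intro set_eqI iffI)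
  fix z assume "z \<in> angle \<alpha> \<beta>"
  then obtain r \<theta> where *: "0 < r" "\<alpha> < \<theta>" "\<theta> < \<beta>" and z: "z = complex_of_real r * cis \<theta>"
    unfolding angle_def by auto
  have "Arg2pi (z * cis (- \<alpha>)) = \<theta> - \<alpha>"
  proof (rule Arg2pi_unique)
    show "complex_of_real r * exp (\<i> * complex_of_real (\<theta> - \<alpha>)) = z * cis (- \<alpha>)"
      unfolding cis_conv_exp[symmetric] z by (simp add: mult.assoc cis_mult)
  qed (use * aperture in auto)
  with * show "z \<in> {z. z \<noteq> 0 \<and> 0 < Arg2pi (z * cis (- \<alpha>)) \<and> Arg2pi (z * cis (- \<alpha>)) < \<beta> - \<alpha>}"
    by (simp add: z)
next
  fix z assume z: "z \<in> {z. z \<noteq> 0 \<and> 0 < Arg2pi (z * cis (- \<alpha>)) \<and> Arg2pi (z * cis (- \<alpha>)) < \<beta> - \<alpha>}"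
  let ?t = "Arg2pi (z * cis (- \<alpha>))"
  have "z * cis (- \<alpha>) = complex_of_real (cmod z) * cis ?t"
    using Arg2pi_eq[of "z * cis (- \<alpha>)"] by (simp add: norm_mult cis_conv_exp)
  then have "z * cis (- \<alpha>) * cis \<alpha> = complex_of_real (cmod z) * cis ?t * cis \<alpha>"
    by simp
  then have "z = complex_of_real (cmod z) * cis (?t + \<alpha>)"
    by (simp add: mult.assoc cis_mult)
  with z show "z \<in> angle \<alpha> \<beta>"
    unfolding angle_def
    by (intro CollectI exI[of _ "cmod z"] exI[of _ "?t + \<alpha>"]) auto
qed

lemma sets_angle [measurable]: "angle \<alpha> \<beta> \<in> sets borel"
  unfolding angle_eq by measurable

lemma Im_tilde_z_pos:
  assumes "z \<in> angle \<alpha> \<beta>"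
  shows "0 < Im (tilde_z \<alpha> \<beta> z)"
proof -
  let ?t = "Arg2pi (z * cis (- \<alpha>))"
  have t: "z \<noteq> 0" "0 < ?t" "?t < \<beta> - \<alpha>" using assms by (auto simp: angle_eq)
  have "a * ?t < a * (\<beta> - \<alpha>)" using t a_pos by (intro mult_strict_left_mono)
  also have "\<dots> = pi" using less by (simp add: a_def)
  finally have "0 < sin (a * ?t)" using t a_pos by (intro sin_gt_zero) auto
  then show ?thesis using t by (simp add: tilde_z_eq angle_pow_def)
qed

lemma cmod_tilde_z: "cmod (tilde_z \<alpha> \<beta> z) = cmod z powr a"
  by (simp add: tilde_z_eq cmod_angle_pow)

text \<open>At the vertex both sides contribute the same parameter \<open>t = 0\<close>, so the two-sided trace of a set
  is a preimage under one parametrisation of the boundary.\<close>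

definition boundary_param :: "real \<Rightarrow> complex" where
  "boundary_param t = (if 0 \<le> t then complex_of_real (t powr ((\<beta> - \<alpha>) / pi)) * cis \<alpha>
     else complex_of_real (\<bar>t\<bar> powr ((\<beta> - \<alpha>) / pi)) * cis \<beta>)"

lemma tilde_set_eq: "tilde_set \<alpha> \<beta> B = boundary_param -` B"
  by (auto simp: tilde_set_def boundary_param_def split: if_splits)

lemma borel_measurable_boundary_param [measurable]: "boundary_param \<in> borel_measurable borel"
  unfolding boundary_param_def by measurable

lemma sets_tilde_set [measurable]: "B \<in> sets borel \<Longrightarrow> tilde_set \<alpha> \<beta> B \<in> sets borel"
  unfolding tilde_set_eq using measurable_sets[OF borel_measurable_boundary_param] by simp

text \<open>The boundary point with parameter \<open>t\<close> has modulus
  \<open>\<bar>t\<bar> powr (1 / a)\<close>, so the trace of a disc of radius \<open>r\<close> lies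
  in an interval of half-length \<open>r powr a\<close>.\<close>

lemma tilde_set_subset:
  assumes "A \<subseteq> cball 0 r"
  shows "tilde_set \<alpha> \<beta> A \<subseteq> {- (r powr a)..r powr a}"
proof
  fix t assume "t \<in> tilde_set \<alpha> \<beta> A"
  then have "cmod (boundary_param t) \<le> r"
    using assms by (auto simp: tilde_set_eq)
  then have "\<bar>t\<bar> powr ((\<beta> - \<alpha>) / pi) \<le> r"
    by (auto simp: boundary_param_def norm_mult split: if_splits)
  then have "(\<bar>t\<bar> powr ((\<beta> - \<alpha>) / pi)) powr a \<le> r powr a"
    using a_pos by (intro powr_mono2) auto
  moreover have "(\<bar>t\<bar> powr ((\<beta> - \<alpha>) / pi)) powr a = \<bar>t\<bar>"
    using less by (simp add: powr_powr a_def)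
  ultimately show "t \<in> {- (r powr a)..r powr a}" by auto
qed

lemma disjoint_tilde_set:
  assumes "disjoint_family_on S P"
  shows "disjoint_family_on (\<lambda>i. tilde_set \<alpha> \<beta> (S i)) P"
  using assms unfolding disjoint_family_on_def tilde_set_eq by blast

lemma integrable_on_tilde_set:
  fixes g :: "real \<Rightarrow> real"
  assumes "\<And>X. continuous_on X g" "A \<in> sets borel" "A \<subseteq> cball 0 r"
  shows "set_integrable lborel (tilde_set \<alpha> \<beta> A) g"
  using tilde_set_subset[OF assms(3)] assms
  by (intro set_integrable_subset[OF borel_integrable_atLeastAtMost'[of "- (r powr a)" "r powr a"]]) auto

lemma sum_abs_tilde_integral_le:
  fixes g :: "real \<Rightarrow> real"
  assumes g: "\<And>X. continuous_on X g" and fin: "finite P" and disj: "disjoint_family_on S P"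
    and S: "\<And>i. i \<in> P \<Longrightarrow> S i \<in> sets borel" "\<And>i. i \<in> P \<Longrightarrow> S i \<subseteq> cball 0 r"
  shows "(\<Sum>i\<in>P. \<bar>LINT t:tilde_set \<alpha> \<beta> (S i)|lborel. g t\<bar>)
     \<le> (LINT t:{- (r powr a)..r powr a}|lborel. \<bar>g t\<bar>)"
  using tilde_set_subset[OF S(2)] S(1)
  by (intro sum_abs_set_integral_le fin disjoint_tilde_set disj borel_integrable_atLeastAtMost' g) auto

lemma sum_abs_tilde_integral_le_const:
  fixes g :: "real \<Rightarrow> real"
  assumes g: "\<And>X. continuous_on X g" and fin: "finite P" and disj: "disjoint_family_on S P"
    and S: "\<And>i. i \<in> P \<Longrightarrow> S i \<in> sets borel" "\<And>i. i \<in> P \<Longrightarrow> S i \<subseteq> cball 0 r"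
    and le: "\<And>t. \<bar>t\<bar> \<le> r powr a \<Longrightarrow> \<bar>g t\<bar> \<le> c"
  shows "(\<Sum>i\<in>P. \<bar>LINT t:tilde_set \<alpha> \<beta> (S i)|lborel. g t\<bar>) \<le> 2 * r powr a * c"
proof -
  have "(LINT t:{- (r powr a)..r powr a}|lborel. \<bar>g t\<bar>) \<le> (LINT t:{- (r powr a)..r powr a}|lborel. c)"
    using le by (intro set_integral_mono borel_integrable_atLeastAtMost' continuous_intros g) auto
  also have "\<dots> = 2 * r powr a * c"
    by (simp add: set_integral_const)
  finally show ?thesis
    using sum_abs_tilde_integral_le[OF g fin disj S] by fastforce
qed

definition poisson :: "complex \<Rightarrow> complex set \<Rightarrow> real" where
  "poisson z B = (1 / pi) * (LINT t:tilde_set \<alpha> \<beta> B|lborel. Im (1 / (complex_of_real t - tilde_z \<alpha> \<beta> z)))"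

definition moment :: "nat \<Rightarrow> complex set \<Rightarrow> real" where
  "moment k B = (1 / pi) * (LINT t:tilde_set \<alpha> \<beta> B|lborel. t ^ (k - 1))"

text \<open>The variables separate: in each correction term the point \<open>z\<close> enters only
  through \<open>Im (inverse (tilde_z \<alpha> \<beta> z ^ k))\<close> and the set only through its
  moment. This form serves near the origin; the next one, with a single kernel, serves far away,
  where cancellation is essential.\<close>

lemma Omega_split:
  "Omega \<alpha> \<beta> q z B = poisson z B + (\<Sum>k=1..q. Im (inverse (tilde_z \<alpha> \<beta> z ^ k)) * moment k B)"
  by (simp add: Omega_def poisson_def moment_def sum_distrib_left mult_ac)

lemma Omega_eq_genus_kernel:
  assumes z: "z \<in> angle \<alpha> \<beta>" and A: "A \<in> sets borel" "A \<subseteq> cball 0 r"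
  shows "Omega \<alpha> \<beta> q z A = (1 / pi) * (LINT t:tilde_set \<alpha> \<beta> A|lborel. genus_kernel q (tilde_z \<alpha> \<beta> z) t)"
proof -
  have 1: "set_integrable lborel (tilde_set \<alpha> \<beta> A) (\<lambda>t. Im (1 / (complex_of_real t - tilde_z \<alpha> \<beta> z)))"
    by (intro integrable_on_tilde_set[OF _ A] continuous_on_resolvent Im_tilde_z_pos z)
  have 2: "set_integrable lborel (tilde_set \<alpha> \<beta> A) (\<lambda>t. c * t ^ n)" for c and n :: nat
    by (intro integrable_on_tilde_set[OF _ A] continuous_intros)
  have 3: "set_integrable lborel (tilde_set \<alpha> \<beta> A)
      (\<lambda>t. \<Sum>k=1..q. Im (inverse (tilde_z \<alpha> \<beta> z ^ k)) * t ^ (k - 1))"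
    by (intro integrable_on_tilde_set[OF _ A] continuous_intros)
  have "(LINT t:tilde_set \<alpha> \<beta> A|lborel. \<Sum>k=1..q. Im (inverse (tilde_z \<alpha> \<beta> z ^ k)) * t ^ (k - 1))
      = (\<Sum>k=1..q. LINT t:tilde_set \<alpha> \<beta> A|lborel. Im (inverse (tilde_z \<alpha> \<beta> z ^ k)) * t ^ (k - 1))"
    unfolding set_lebesgue_integral_def scaleR_sum_right
    using 2 by (intro Bochner_Integration.integral_sum) (auto simp: set_integrable_def)
  also have "\<dots> = (\<Sum>k=1..q. Im (inverse (tilde_z \<alpha> \<beta> z ^ k)) * (LINT t:tilde_set \<alpha> \<beta> A|lborel. t ^ (k - 1)))"
    by (simp only: set_integral_mult_right)
  finally show ?thesis
    unfolding Omega_def genus_kernel_def set_integral_add(2)[OF 1 3]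
    by (simp only: distrib_left)
qed

lemma poisson_nonneg:
  assumes "z \<in> angle \<alpha> \<beta>"
  shows "0 \<le> poisson z A"
  unfolding poisson_def set_lebesgue_integral_def Im_resolvent using Im_tilde_z_pos[OF assms]
  by (intro mult_nonneg_nonneg integral_nonneg_AE) auto

lemma sum_poisson_le_1:
  assumes z: "z \<in> angle \<alpha> \<beta>" and fin: "finite P" and disj: "disjoint_family_on S P"
    and S: "\<And>i. i \<in> P \<Longrightarrow> S i \<in> sets borel" "\<And>i. i \<in> P \<Longrightarrow> S i \<subseteq> cball 0 r"
  shows "(\<Sum>i\<in>P. poisson z (S i)) \<le> 1"
proof -
  let ?w = "tilde_z \<alpha> \<beta> z"
  have w: "0 < Im ?w" using Im_tilde_z_pos[OF z] .
  have "(\<Sum>i\<in>P. poisson z (S i)) \<le> (1 / pi) * (\<Sum>i\<in>P. \<bar>LINT t:tilde_set \<alpha> \<beta> (S i)|lborel. Im (1 / (complex_of_real t - ?w))\<bar>)"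
    unfolding poisson_def sum_distrib_left[symmetric] by (intro mult_left_mono sum_mono) auto
  also have "\<dots> \<le> (1 / pi) * (LINT t:{- (r powr a)..r powr a}|lborel. \<bar>Im (1 / (complex_of_real t - ?w))\<bar>)"
    by (intro mult_left_mono sum_abs_tilde_integral_le fin disj S continuous_on_resolvent w) auto
  also have "(LINT t:{- (r powr a)..r powr a}|lborel. \<bar>Im (1 / (complex_of_real t - ?w))\<bar>)
      = (LINT t:{- (r powr a)..r powr a}|lborel. Im (1 / (complex_of_real t - ?w)))"
    unfolding Im_resolvent using w by simp
  also have "(1 / pi) * \<dots> \<le> (1 / pi) * pi"
    by (intro mult_left_mono poisson_integral_le w) auto
  finally show ?thesis by simp
qed

lemma sum_moment_le:
  assumes k: "1 \<le> k" and fin: "finite P" and disj: "disjoint_family_on S P"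
    and S: "\<And>i. i \<in> P \<Longrightarrow> S i \<in> sets borel" "\<And>i. i \<in> P \<Longrightarrow> S i \<subseteq> cball 0 r"
  shows "(\<Sum>i\<in>P. \<bar>moment k (S i)\<bar>) \<le> (r powr a) ^ k"
proof -
  have "(\<Sum>i\<in>P. \<bar>moment k (S i)\<bar>) = (1 / pi) * (\<Sum>i\<in>P. \<bar>LINT t:tilde_set \<alpha> \<beta> (S i)|lborel. t ^ (k - 1)\<bar>)"
    unfolding moment_def by (simp add: abs_mult sum_distrib_left)
  \<comment> \<open>The largest value of the integrand times the length of the interval; the factor
    \<open>2 / pi\<close> that arises is below \<open>1\<close>.\<close>
  also have "\<dots> \<le> (1 / pi) * (2 * r powr a * (r powr a) ^ (k - 1))"
    by (intro mult_left_mono sum_abs_tilde_integral_le_const fin disj S continuous_intros)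
       (auto simp: power_abs intro!: power_mono)
  also have "\<dots> = (2 / pi) * (r powr a) ^ k"
    using k by (cases k) auto
  also have "\<dots> \<le> 1 * (r powr a) ^ k"
    using pi_gt3 by (intro mult_right_mono) auto
  finally show ?thesis by simp
qed

text \<open>Bound the kernel by \<open>genus_kernel_far\<close> on an interval of length
  \<open>2 * r powr a\<close>. The resulting power of \<open>cmod z\<close> decays at the rate
  \<open>a * (q + 1)\<close>, which exceeds \<open>p\<close> in \<open>swept_measure\<close> and so
  can be integrated by \<open>tail_integral\<close>.\<close>

lemma sum_Omega_far_le:
  assumes z: "z \<in> angle \<alpha> \<beta>" and r: "0 < r" and far: "2 * r powr a \<le> cmod z powr a"
    and fin: "finite P" and disj: "disjoint_family_on S P"
    and S: "\<And>i. i \<in> P \<Longrightarrow> S i \<in> sets borel" "\<And>i. i \<in> P \<Longrightarrow> S i \<subseteq> cball 0 r"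
  shows "(\<Sum>i\<in>P. \<bar>Omega \<alpha> \<beta> q z (S i)\<bar>) \<le> 2 * r powr (a * (q + 1)) * cmod z powr (- (a * (q + 1)))"
proof -
  let ?w = "tilde_z \<alpha> \<beta> z"
  have zp: "0 < cmod z" using z by (simp add: angle_eq)
  have "(\<Sum>i\<in>P. \<bar>Omega \<alpha> \<beta> q z (S i)\<bar>)
      = (1 / pi) * (\<Sum>i\<in>P. \<bar>LINT t:tilde_set \<alpha> \<beta> (S i)|lborel. genus_kernel q ?w t\<bar>)"
    using Omega_eq_genus_kernel[OF z S] by (simp add: abs_mult sum_distrib_left)
  also have "\<dots> \<le> (1 / pi) * (2 * r powr a * (2 * (r powr a) ^ q / cmod ?w ^ Suc q))"
    using r far
    by (intro mult_left_mono sum_abs_tilde_integral_le_const fin disj S continuous_on_genus_kernel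
        Im_tilde_z_pos z genus_kernel_far) (auto simp: cmod_tilde_z)
  also have "\<dots> = (4 / pi) * ((r powr a) ^ Suc q / (cmod z powr a) ^ Suc q)"
    by (simp add: cmod_tilde_z)
  also have "\<dots> = (4 / pi) * (r powr (a * (q + 1)) * cmod z powr (- (a * (q + 1))))"
    unfolding powr_power_nat[OF r] powr_power_nat[OF zp] by (simp add: powr_minus divide_inverse add.commute)
  also have "\<dots> \<le> 2 * (r powr (a * (q + 1)) * cmod z powr (- (a * (q + 1))))"
    using pi_gt3 by (intro mult_right_mono) (auto simp: field_simps)
  finally show ?thesis by simp
qed

end

text \<open>Transfers a bound on the variation of the harmonic charge at each point \<open>x\<close>
  to the variation of the swept set function.\<close>

lemma sum_abs_integral_le:
  fixes g :: "'a \<Rightarrow> real"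
  assumes f: "\<And>i. i \<in> P \<Longrightarrow> set_integrable M X (f i)" and g: "set_integrable M X g"
    and le: "\<And>x. x \<in> X \<Longrightarrow> (\<Sum>i\<in>P. \<bar>f i x\<bar>) \<le> g x"
  shows "(\<Sum>i\<in>P. \<bar>LINT x:X|M. f i x\<bar>) \<le> (LINT x:X|M. g x)"
proof -
  have absf: "set_integrable M X (\<lambda>x. \<bar>f i x\<bar>)" if "i \<in> P" for i
    using set_integrable_abs[OF f[OF that]] .
  have "(\<Sum>i\<in>P. \<bar>LINT x:X|M. f i x\<bar>) \<le> (\<Sum>i\<in>P. LINT x:X|M. \<bar>f i x\<bar>)"
    using set_integral_norm_bound[OF f] by (intro sum_mono) simp
  also have "\<dots> = (\<integral>x. (\<Sum>i\<in>P. indicator X x *\<^sub>R \<bar>f i x\<bar>) \<partial>M)"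
    unfolding set_lebesgue_integral_def
    using absf by (intro Bochner_Integration.integral_sum[symmetric]) (auto simp: set_integrable_def)
  also have "\<dots> \<le> (LINT x:X|M. g x)"
    unfolding set_lebesgue_integral_def
  proof (rule integral_mono)
    show "integrable M (\<lambda>x. \<Sum>i\<in>P. indicator X x *\<^sub>R \<bar>f i x\<bar>)"
      using absf by (intro Bochner_Integration.integrable_sum) (auto simp: set_integrable_def)
    show "integrable M (\<lambda>x. indicator X x *\<^sub>R g x)"
      using g by (simp add: set_integrable_def)
    show "(\<Sum>i\<in>P. indicator X x *\<^sub>R \<bar>f i x\<bar>) \<le> indicator X x *\<^sub>R g x" for x
      using le[of x] by (auto simp: indicator_def)
  qed
  finally show ?thesis .
qed

context sector
begin

lemma inverse_tilde_z_power:
  assumes "z \<noteq> 0"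
  shows "inverse (tilde_z \<alpha> \<beta> z ^ k) = inverse (angle_pow \<alpha> (a * real k) z)"
  using assms by (simp add: tilde_z_eq angle_pow_power)

lemma abs_Im_inverse_tilde_z_power:
  "\<bar>Im (inverse (tilde_z \<alpha> \<beta> z ^ k))\<bar> \<le> cmod z powr (- (a * real k))" if "z \<noteq> 0"
proof -
  have "\<bar>Im (inverse (tilde_z \<alpha> \<beta> z ^ k))\<bar> \<le> cmod (inverse (tilde_z \<alpha> \<beta> z ^ k))"
    by (rule abs_Im_le_cmod)
  also have "\<dots> = cmod z powr (- (a * real k))"
    using that by (simp add: inverse_tilde_z_power norm_inverse cmod_angle_pow powr_minus)
  finally show ?thesis .
qed

text \<open>The ratio of radii for which \<open>cmod z = c * r\<close> corresponds to modulus
  \<open>2 * r powr a\<close> in the half-plane.\<close>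

definition c :: real where "c = 2 powr (1 / a)"

lemma c_gt_1: "1 < c"
  unfolding c_def using a_pos by (intro gr_one_powr) auto

lemma far_if: "2 * r powr a \<le> cmod z powr a" if "0 < r" "c * r \<le> cmod z"
proof -
  have "(c * r) powr a \<le> cmod z powr a"
    using that a_pos c_gt_1 by (intro powr_mono2) auto
  then show ?thesis
    using that a_pos c_gt_1 by (simp add: powr_mult c_def powr_powr)
qed

text \<open>For fixed \<open>z\<close> the kernel is continuous, hence absolutely integrable over
  the compact interval containing all traces. Its integral therefore bounds every partial sum of
  absolute values, and countable additivity of the integral applies.\<close>

lemma Omega_sums:
  assumes z: "z \<in> angle \<alpha> \<beta>" and A: "range A \<subseteq> sets borel" "disjoint_family A" "(\<Union>n. A n) \<subseteq> cball 0 r"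
  shows "(\<lambda>n. Omega \<alpha> \<beta> q z (A n)) sums Omega \<alpha> \<beta> q z (\<Union>n. A n)"
proof -
  let ?g = "genus_kernel q (tilde_z \<alpha> \<beta> z)"
  let ?T = "\<lambda>n. tilde_set \<alpha> \<beta> (A n)"
  have cont: "continuous_on X ?g" for X
    by (intro continuous_on_genus_kernel Im_tilde_z_pos z)
  have An: "A n \<in> sets borel" "A n \<subseteq> cball 0 r" for n
    using A by auto
  have Un: "(\<Union>n. A n) \<in> sets borel" using An by auto
  have TU: "tilde_set \<alpha> \<beta> (\<Union>n. A n) = (\<Union>n. ?T n)"
    by (auto simp: tilde_set_eq)
  have "summable (\<lambda>n. \<bar>LINT t:?T n|lborel. ?g t\<bar>)"
  proof (rule bounded_imp_summable)
    show "(\<Sum>n\<le>N. \<bar>LINT t:?T n|lborel. ?g t\<bar>) \<le> (LINT t:{- (r powr a)..r powr a}|lborel. \<bar>?g t\<bar>)" for N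
      using A(2) by (intro sum_abs_tilde_integral_le cont An) (auto simp: disjoint_family_on_def)
  qed auto
  then have "summable (\<lambda>n. LINT t:?T n|lborel. ?g t)"
    by (rule summable_rabs_cancel)
  then have "(\<lambda>n. LINT t:?T n|lborel. ?g t) sums (\<Sum>n. LINT t:?T n|lborel. ?g t)"
    by (rule summable_sums)
  also have "(\<Sum>n. LINT t:?T n|lborel. ?g t) = (LINT t:(\<Union>n. ?T n)|lborel. ?g t)"
  proof (rule lebesgue_integral_countable_add[symmetric])
    show "?T n \<in> sets lborel" for n
      using sets_tilde_set[OF An(1)] by simp
    show "?T i \<inter> ?T j = {}" if "i \<noteq> j" for i j
      using disjoint_tilde_set[OF A(2)] that by (auto simp: disjoint_family_on_def)
    show "set_integrable lborel (\<Union>n. ?T n) ?g"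
      using integrable_on_tilde_set[OF cont Un A(3)] by (simp add: TU)
  qed
  finally have "(\<lambda>n. (1 / pi) * (LINT t:?T n|lborel. ?g t)) sums ((1 / pi) * (LINT t:(\<Union>n. ?T n)|lborel. ?g t))"
    by (rule sums_mult)
  then show ?thesis
    using Omega_eq_genus_kernel[OF z An] Omega_eq_genus_kernel[OF z Un A(3)] by (simp add: TU)
qed

lemma borel_measurable_poisson [measurable]:
  assumes [measurable]: "A \<in> sets borel"
  shows "(\<lambda>z. poisson z A) \<in> borel_measurable borel"
  unfolding poisson_def set_lebesgue_integral_def by measurable

lemma borel_measurable_Omega [measurable]:
  assumes [measurable]: "A \<in> sets borel"
  shows "(\<lambda>z. Omega \<alpha> \<beta> q z A) \<in> borel_measurable borel"
  unfolding Omega_split by measurable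

end

subsection \<open>Sweeping a positive measure\<close>

text \<open>The two inequalities express that \<open>q\<close> is the integer part of
  \<open>p / a\<close>. The first keeps every correction term at or below the critical exponent, the
  second makes the far part converge.\<close>

locale swept_measure = sector \<alpha> \<beta> + growth_measure M K p r0
  for \<alpha> \<beta> M K p r0 +
  fixes q :: nat
  assumes genus: "a * real q \<le> p" "p < a * real (q + 1)"
begin

text \<open>The constant may depend on \<open>r\<close>, but it serves all finite disjoint families
  at once and the majorant is integrable away from the origin. It yields existence and countable
  additivity, not the growth estimate. The index type is left open, so that both single sets and
  initial segments of sequences fit.\<close>

lemma sum_Omega_dominated:
  assumes r: "0 < r"
  shows "\<exists>C\<ge>0. \<forall>z\<in>angle \<alpha> \<beta>. r0 \<le> cmod z \<longrightarrow> (\<forall>P S. finite (P :: 'i set) \<longrightarrow> disjoint_family_on S P \<longrightarrow>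
     (\<forall>i\<in>P. S i \<in> sets borel \<and> S i \<subseteq> cball 0 r) \<longrightarrow>
     (\<Sum>i\<in>P. \<bar>Omega \<alpha> \<beta> q z (S i)\<bar>) \<le> C * cmod z powr (- (a * (q + 1))))"
proof -
  define s where "s = a * real (q + 1)"
  have s: "0 \<le> s" using a_pos by (simp add: s_def)
  \<comment> \<open>Bound for nearby points: \<open>1\<close> from the Poisson mass, and one summand
    per moment, with negative powers of \<open>z\<close> estimated at
    \<open>cmod z = r0\<close>.\<close>
  define b where "b = 1 + (\<Sum>k=1..q. r0 powr (- (a * real k)) * (r powr a) ^ k)"
  have b: "1 \<le> b" unfolding b_def by (simp add: sum_nonneg)
  \<comment> \<open>The first summand serves far points. For near points
    \<open>cmod z < c * r\<close>, so the constant \<open>b\<close> is at most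
    \<open>b * (c * r) powr s * cmod z powr (- s)\<close>.\<close>
  define C where "C = 2 * r powr s + b * (c * r) powr s"
  have C: "0 \<le> C" using b by (simp add: C_def)
  have "(\<Sum>i\<in>P. \<bar>Omega \<alpha> \<beta> q z (S i)\<bar>) \<le> C * cmod z powr (- s)"
    if z: "z \<in> angle \<alpha> \<beta>" "r0 \<le> cmod z" and P: "finite P" "disjoint_family_on S P"
      and S: "\<forall>i\<in>P. S i \<in> sets borel \<and> S i \<subseteq> cball 0 r" for z and P :: "'i set" and S
  proof (cases "c * r \<le> cmod z")
    case True
    have "(\<Sum>i\<in>P. \<bar>Omega \<alpha> \<beta> q z (S i)\<bar>) \<le> 2 * r powr s * cmod z powr (- s)"
      using sum_Omega_far_le[OF z(1) r far_if[OF r True] P] S by (simp add: s_def)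
    also have "\<dots> \<le> C * cmod z powr (- s)"
      using b by (intro mult_right_mono) (auto simp: C_def)
    finally show ?thesis .
  next
    case False
    have z0: "z \<noteq> 0" using z r0_pos by auto
    have "(\<Sum>i\<in>P. \<bar>Omega \<alpha> \<beta> q z (S i)\<bar>)
        \<le> (\<Sum>i\<in>P. poisson z (S i) + (\<Sum>k=1..q. \<bar>Im (inverse (tilde_z \<alpha> \<beta> z ^ k))\<bar> * \<bar>moment k (S i)\<bar>))"
    proof (rule sum_mono)
      fix i
      have "\<bar>Omega \<alpha> \<beta> q z (S i)\<bar> \<le> \<bar>poisson z (S i)\<bar> + \<bar>\<Sum>k=1..q. Im (inverse (tilde_z \<alpha> \<beta> z ^ k)) * moment k (S i)\<bar>"
        unfolding Omega_split by (rule abs_triangle_ineq)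
      also have "\<dots> \<le> poisson z (S i) + (\<Sum>k=1..q. \<bar>Im (inverse (tilde_z \<alpha> \<beta> z ^ k)) * moment k (S i)\<bar>)"
        using poisson_nonneg[OF z(1)] by (intro add_mono sum_abs) auto
      finally show "\<bar>Omega \<alpha> \<beta> q z (S i)\<bar> \<le> poisson z (S i) + (\<Sum>k=1..q. \<bar>Im (inverse (tilde_z \<alpha> \<beta> z ^ k))\<bar> * \<bar>moment k (S i)\<bar>)"
        by (simp only: abs_mult)
    qed
    also have "\<dots> = (\<Sum>i\<in>P. poisson z (S i)) + (\<Sum>k=1..q. \<bar>Im (inverse (tilde_z \<alpha> \<beta> z ^ k))\<bar> * (\<Sum>i\<in>P. \<bar>moment k (S i)\<bar>))"
      unfolding sum.distrib sum_distrib_left by (subst (2) sum.swap) simp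
    also have "\<dots> \<le> b"
      unfolding b_def
    proof (intro add_mono sum_mono mult_mono)
      show "(\<Sum>i\<in>P. poisson z (S i)) \<le> 1"
        using sum_poisson_le_1[OF z(1) P] S by blast
      fix k assume k: "k \<in> {1..q}"
      show "(\<Sum>i\<in>P. \<bar>moment k (S i)\<bar>) \<le> (r powr a) ^ k"
        using sum_moment_le[OF _ P] S k by auto
      have "cmod z powr (- (a * real k)) \<le> r0 powr (- (a * real k))"
        using z r0_pos a_pos by (intro powr_mono2') auto
      then show "\<bar>Im (inverse (tilde_z \<alpha> \<beta> z ^ k))\<bar> \<le> r0 powr (- (a * real k))"
        using abs_Im_inverse_tilde_z_power[OF z0] by (rule order_trans[rotated])
    qed (auto intro: sum_nonneg)
    also have "b = b * (cmod z powr s * cmod z powr (- s))"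
      using z0 by (simp flip: powr_add)
    also have "\<dots> \<le> b * ((c * r) powr s * cmod z powr (- s))"
      using False b s by (intro mult_left_mono mult_right_mono powr_mono2) auto
    also have "\<dots> \<le> C * cmod z powr (- s)"
      by (simp add: C_def distrib_right)
    finally show ?thesis .
  qed
  then show ?thesis
    using C unfolding s_def by blast
qed

lemma integrable_dominated:
  fixes f :: "complex \<Rightarrow> real"
  assumes [measurable]: "f \<in> borel_measurable borel"
    and le: "\<And>z. z \<in> angle \<alpha> \<beta> \<Longrightarrow> r0 \<le> cmod z \<Longrightarrow> \<bar>f z\<bar> \<le> C * cmod z powr (- (a * real (q + 1)))"
  shows "set_integrable M (angle \<alpha> \<beta>) f"
  unfolding set_integrable_def
proof (rule Bochner_Integration.integrable_bound)
  show "integrable M (\<lambda>z. C * (indicator {z. r0 \<le> cmod z} z *\<^sub>R cmod z powr (- (a * real (q + 1)))))"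
    using tail_integral(1)[OF genus(2) r0_pos] by (intro integrable_mult_right) (simp add: set_integrable_def)
  show "AE z in M. norm (indicator (angle \<alpha> \<beta>) z *\<^sub>R f z)
      \<le> norm (C * (indicator {z. r0 \<le> cmod z} z *\<^sub>R cmod z powr (- (a * real (q + 1)))))"
    using AE_ge_r0
  proof eventually_elim
    case (elim z)
    then show ?case
      using le[of z] by (cases "z \<in> angle \<alpha> \<beta>") (auto intro: order_trans[OF _ abs_ge_self])
  qed
qed measurable

lemma integrable_Omega:
  assumes A: "A \<in> sets borel" "A \<subseteq> cball 0 r" and r: "0 < r"
  shows "set_integrable M (angle \<alpha> \<beta>) (\<lambda>z. Omega \<alpha> \<beta> q z A)"
proof -
  obtain C where "\<forall>z\<in>angle \<alpha> \<beta>. r0 \<le> cmod z \<longrightarrow> (\<forall>P S. finite (P :: unit set) \<longrightarrow> disjoint_family_on S P \<longrightarrow>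
     (\<forall>i\<in>P. S i \<in> sets borel \<and> S i \<subseteq> cball 0 r) \<longrightarrow>
     (\<Sum>i\<in>P. \<bar>Omega \<alpha> \<beta> q z (S i)\<bar>) \<le> C * cmod z powr (- (a * (q + 1))))"
    using sum_Omega_dominated[OF r] by metis
  \<comment> \<open>A single set is a disjoint family indexed by the one-element type.\<close>
  from this[rule_format, of _ "{()}" "\<lambda>_. A"] show ?thesis
    using A by (intro integrable_dominated[where C = C]) (auto simp: disjoint_family_on_def)
qed

text \<open>Additivity at each point passes through the integral by dominated convergence; the
  majorant for the partial sums does not depend on \<open>N\<close>, because the previous bound
  covers every finite family.\<close>

lemma integral_Omega_sums:
  assumes A: "range A \<subseteq> sets borel" "disjoint_family A" "(\<Union>n. A n) \<subseteq> cball 0 r" and r: "0 < r"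
  shows "(\<lambda>n. LINT z:angle \<alpha> \<beta>|M. Omega \<alpha> \<beta> q z (A n)) sums (LINT z:angle \<alpha> \<beta>|M. Omega \<alpha> \<beta> q z (\<Union>n. A n))"
proof -
  obtain C where C0: "0 \<le> C" and C: "\<forall>z\<in>angle \<alpha> \<beta>. r0 \<le> cmod z \<longrightarrow> (\<forall>P S. finite (P :: nat set) \<longrightarrow> disjoint_family_on S P \<longrightarrow>
     (\<forall>i\<in>P. S i \<in> sets borel \<and> S i \<subseteq> cball 0 r) \<longrightarrow>
     (\<Sum>i\<in>P. \<bar>Omega \<alpha> \<beta> q z (S i)\<bar>) \<le> C * cmod z powr (- (a * (q + 1))))"
    using sum_Omega_dominated[OF r] by metis
  let ?X = "angle \<alpha> \<beta>" and ?O = "\<lambda>B z. Omega \<alpha> \<beta> q z B"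
  have An: "A n \<in> sets borel" "A n \<subseteq> cball 0 r" for n using A by auto
  note [measurable] = An(1)
  have [measurable]: "(\<Union>n. A n) \<in> sets borel" using An by auto
  let ?g = "\<lambda>z. C * (indicator {z. r0 \<le> cmod z} z *\<^sub>R cmod z powr (- (a * real (q + 1))))"
  have "(\<lambda>N. \<integral>z. (\<Sum>n<N. indicator ?X z *\<^sub>R ?O (A n) z) \<partial>M) \<longlonglongrightarrow> (LINT z:?X|M. ?O (\<Union>n. A n) z)"
    unfolding set_lebesgue_integral_def
  proof (rule integral_dominated_convergence[where w = ?g])
    show "integrable M ?g"
      using tail_integral(1)[OF genus(2) r0_pos] by (intro integrable_mult_right) (simp add: set_integrable_def)
    show "AE z in M. (\<lambda>N. \<Sum>n<N. indicator ?X z *\<^sub>R ?O (A n) z) \<longlonglongrightarrow> indicator ?X z *\<^sub>R ?O (\<Union>n. A n) z"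
    proof (rule AE_I2)
      fix z
      show "(\<lambda>N. \<Sum>n<N. indicator ?X z *\<^sub>R ?O (A n) z) \<longlonglongrightarrow> indicator ?X z *\<^sub>R ?O (\<Union>n. A n) z"
        using Omega_sums[OF _ A] by (cases "z \<in> ?X") (auto simp: sums_def)
    qed
    show "AE z in M. norm (\<Sum>n<N. indicator ?X z *\<^sub>R ?O (A n) z) \<le> ?g z" for N
      using AE_ge_r0
    proof eventually_elim
      case (elim z)
      show ?case
      proof (cases "z \<in> ?X")
        case True
        have "\<bar>\<Sum>n<N. ?O (A n) z\<bar> \<le> (\<Sum>n<N. \<bar>?O (A n) z\<bar>)" by (rule sum_abs)
        also have "\<dots> \<le> C * cmod z powr (- (a * real (q + 1)))"
          using An A(2) by (intro C[rule_format] True elim) (auto simp: disjoint_family_on_def)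
        finally show ?thesis using True elim by simp
      next
        case False
        then show ?thesis using C0 elim by simp
      qed
    qed
  qed measurable
  also have "(\<lambda>N. \<integral>z. (\<Sum>n<N. indicator ?X z *\<^sub>R ?O (A n) z) \<partial>M) = (\<lambda>N. \<Sum>n<N. LINT z:?X|M. ?O (A n) z)"
    unfolding set_lebesgue_integral_def using integrable_Omega[OF An r]
    by (intro ext Bochner_Integration.integral_sum) (auto simp: set_integrable_def)
  finally show ?thesis by (simp add: sums_def)
qed

end

section \<open>Variation of the sweep on a disc: far part, Poisson part, outside part and
  moments\<close>

definition borel_packing :: "real \<Rightarrow> complex set set \<Rightarrow> bool" where
  "borel_packing r P \<longleftrightarrow> finite P \<and> disjoint P \<and> P \<subseteq> sets borel \<and> \<Union>P \<subseteq> cball 0 r"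

lemma borel_packingD:
  assumes "borel_packing r P"
  shows "finite P" "disjoint_family_on (\<lambda>A. A) P"
    "A \<in> P \<Longrightarrow> A \<in> sets borel" "A \<in> P \<Longrightarrow> A \<subseteq> cball 0 r"
  using assms by (auto simp: borel_packing_def disjoint_def disjoint_family_on_def)

lemma setfun_rad_le:
  assumes "\<And>P. borel_packing r P \<Longrightarrow> (\<Sum>A\<in>P. \<bar>lam A\<bar>) \<le> X"
  shows "setfun_rad lam r \<le> ennreal X"
  unfolding setfun_rad_def setfun_variation_def
proof (rule SUP_least)
  fix P :: "complex set set"
  assume "P \<in> {P. finite P \<and> disjoint P \<and> P \<subseteq> sets borel \<and> \<Union>P \<subseteq> cball 0 r}"
  then have "borel_packing r P" by (simp add: borel_packing_def)
  then show "(\<Sum>A\<in>P. ennreal \<bar>lam A\<bar>) \<le> ennreal X"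
    using assms by (subst sum_ennreal) (auto intro: ennreal_leI)
qed

context swept_measure
begin

lemma powr_cr: "0 < r \<Longrightarrow> (c * r) powr s = c powr s * r powr s"
  using c_gt_1 by (simp add: powr_mult)

lemma far_sum_le:
  "\<exists>C\<ge>0. \<forall>r>0. \<forall>P. borel_packing r P \<longrightarrow>
     (\<Sum>A\<in>P. \<bar>LINT z:angle \<alpha> \<beta> - ball 0 (c * r)|M. Omega \<alpha> \<beta> q z A\<bar>) \<le> C * r powr p"
proof -
  define s where "s = a * real (q + 1)"
  \<comment> \<open>The factor \<open>2\<close> of the far kernel times the tail constant at the
    radius \<open>c * r\<close>; the powers recombine as
    \<open>r powr s * r powr (p - s) = r powr p\<close>.\<close>
  define C where "C = 2 * (K * 2 powr p / (1 - 2 powr (p - s)) * c powr (p - s))"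
  have s: "p < s" using genus(2) by (simp add: s_def)
  have "2 powr (p - s) < (1::real)" using s powr_less_cancel_iff[of 2 _ 0] by simp
  then have C0: "0 \<le> C" using K_nonneg by (simp add: C_def)
  have "(\<Sum>A\<in>P. \<bar>LINT z:angle \<alpha> \<beta> - ball 0 (c * r)|M. Omega \<alpha> \<beta> q z A\<bar>) \<le> C * r powr p"
    if r: "0 < r" and P: "borel_packing r P" for r P
  proof -
    note P = borel_packingD[OF P]
    let ?X = "angle \<alpha> \<beta> - ball 0 (c * r)" and ?Y = "{z :: complex. c * r \<le> cmod z}"
    let ?g = "\<lambda>z. 2 * r powr s * cmod z powr (- s)"
    have cr: "0 < c * r" using r c_gt_1 by simp
    have XY: "?X \<subseteq> ?Y" by auto
    have gY: "set_integrable M ?Y ?g"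
      using tail_integral(1)[OF s cr] by (intro set_integrable_mult_right) auto
    have gX: "set_integrable M ?X ?g"
      by (rule set_integrable_subset[OF gY _ XY]) measurable
    have "(\<Sum>A\<in>P. \<bar>LINT z:?X|M. Omega \<alpha> \<beta> q z A\<bar>) \<le> (LINT z:?X|M. ?g z)"
    proof (rule sum_abs_integral_le[OF _ gX])
      show "set_integrable M ?X (\<lambda>z. Omega \<alpha> \<beta> q z A)" if "A \<in> P" for A
        by (rule set_integrable_subset[OF integrable_Omega[OF P(3,4)[OF that] r]]) auto
      show "(\<Sum>A\<in>P. \<bar>Omega \<alpha> \<beta> q z A\<bar>) \<le> ?g z" if "z \<in> ?X" for z
        using sum_Omega_far_le[OF _ r far_if[OF r] P(1,2), of z] P(3,4) that by (simp add: s_def)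
    qed
    also have "\<dots> \<le> (LINT z:?Y|M. ?g z)"
      using gX gY XY unfolding set_lebesgue_integral_def set_integrable_def
      by (intro integral_mono) (auto simp: indicator_def)
    also have "\<dots> = 2 * r powr s * (LINT z:?Y|M. cmod z powr (- s))"
      by simp
    also have "\<dots> \<le> 2 * r powr s * (K * 2 powr p / (1 - 2 powr (p - s)) * (c * r) powr (p - s))"
      using tail_integral(2)[OF s cr] by (intro mult_left_mono) auto
    also have "\<dots> = C * (r powr s * r powr (p - s))"
      unfolding powr_cr[OF r] by (simp add: C_def)
    also have "r powr s * r powr (p - s) = r powr p"
      by (simp flip: powr_add)
    finally show ?thesis .
  qed
  with C0 show ?thesis by blast
qed

lemma measure_subset_cball:
  assumes "0 \<le> r" "A \<subseteq> cball 0 r"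
  shows "measure M A \<le> K * r powr p"
  using emeasure_subset_cball[OF assms] K_nonneg unfolding measure_def
  by (metis enn2real_leI mult_nonneg_nonneg powr_ge_zero)

lemma integrable_const_on_ball: "set_integrable M (ball 0 r \<inter> angle \<alpha> \<beta>) (\<lambda>_. b :: real)"
  by (rule integrable_bounded_on_ball[where b = "\<bar>b\<bar>" and r = r]) auto

lemma integrable_poisson:
  assumes A: "A \<in> sets borel" "A \<subseteq> cball 0 r"
  shows "set_integrable M (ball 0 \<rho> \<inter> angle \<alpha> \<beta>) (\<lambda>z. poisson z A)"
proof (rule integrable_bounded_on_ball[where b = 1 and r = \<rho>])
  fix z assume "z \<in> ball 0 \<rho> \<inter> angle \<alpha> \<beta>"
  then show "\<bar>poisson z A\<bar> \<le> 1"
    using sum_poisson_le_1[of z "{()}" "\<lambda>_. A" r] poisson_nonneg[of z A] A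
    by (auto simp: disjoint_family_on_def)
qed (use A in auto)

text \<open>Each point spreads Poisson mass at most one, so the variation is at most the mass of the
  disc of radius \<open>c * r\<close>.\<close>

lemma poisson_sum_le:
  assumes r: "0 < r" and P: "borel_packing r P"
  shows "(\<Sum>A\<in>P. \<bar>LINT z:ball 0 (c * r) \<inter> angle \<alpha> \<beta>|M. poisson z A\<bar>) \<le> K * c powr p * r powr p"
proof -
  note P = borel_packingD[OF P]
  let ?X = "ball 0 (c * r) \<inter> angle \<alpha> \<beta>"
  have "(\<Sum>A\<in>P. \<bar>LINT z:?X|M. poisson z A\<bar>) \<le> (LINT z:?X|M. 1)"
  proof (rule sum_abs_integral_le)
    show "set_integrable M ?X (\<lambda>z. poisson z A)" if "A \<in> P" for A
      by (rule integrable_poisson[OF P(3,4)[OF that]])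
    show "set_integrable M ?X (\<lambda>_. 1 :: real)"
      by (rule integrable_const_on_ball)
    show "(\<Sum>A\<in>P. \<bar>poisson z A\<bar>) \<le> 1" if "z \<in> ?X" for z
      using sum_poisson_le_1[OF _ P(1,2), of z r] P(3,4) poisson_nonneg[of z] that by simp
  qed
  also have "\<dots> = measure M ?X"
    by (simp add: set_lebesgue_integral_def)
  also have "\<dots> \<le> K * (c * r) powr p"
    using r c_gt_1 by (intro measure_subset_cball) auto
  finally show ?thesis
    by (simp add: powr_cr[OF r])
qed

lemma finite_emeasure_subset_cball:
  assumes "A \<subseteq> cball 0 r"
  shows "emeasure M A < \<infinity>"
proof -
  have "emeasure M A \<le> ennreal (K * \<bar>r\<bar> powr p)"
    by (rule emeasure_subset_cball) (use assms in auto)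
  then show ?thesis
    using le_less_trans by fastforce
qed

lemma outside_sum_le:
  assumes r: "0 < r" and P: "borel_packing r P"
  shows "(\<Sum>A\<in>P. \<bar>measure M (A - angle \<alpha> \<beta>)\<bar>) \<le> K * r powr p"
proof -
  note P = borel_packingD[OF P]
  have fin: "emeasure M (A - angle \<alpha> \<beta>) < \<infinity>" if "A \<in> P" for A
    by (rule finite_emeasure_subset_cball[of _ r]) (use P(4)[OF that] in auto)
  have "(\<Sum>A\<in>P. \<bar>measure M (A - angle \<alpha> \<beta>)\<bar>) = measure M (\<Union>A\<in>P. A - angle \<alpha> \<beta>)"
    using P fin by (subst measure_finite_Union) (auto simp: disjoint_family_on_def less_top)
  also have "\<dots> \<le> K * r powr p"
    using r P by (intro measure_subset_cball) auto
  finally show ?thesis .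
qed

text \<open>With cut radius \<open>c * r\<close> this is the coefficient of \<open>moment k\<close>
  in the near part of the sweep; with cut radius \<open>r\<close> it gives the extra term of the
  final bound.\<close>

definition power_integral :: "nat \<Rightarrow> real \<Rightarrow> real" where
  "power_integral k \<rho> = (LINT z:ball 0 \<rho> \<inter> angle \<alpha> \<beta>|M. Im (inverse (tilde_z \<alpha> \<beta> z ^ k)))"

lemma zero_notin_angle: "0 \<notin> angle \<alpha> \<beta>"
  by (simp add: angle_eq)

lemma abs_Im_inverse_le_r0:
  assumes "z \<in> angle \<alpha> \<beta>" "r0 \<le> cmod z"
  shows "\<bar>Im (inverse (tilde_z \<alpha> \<beta> z ^ k))\<bar> \<le> r0 powr (- (a * real k))"
proof -
  have "\<bar>Im (inverse (tilde_z \<alpha> \<beta> z ^ k))\<bar> \<le> cmod z powr (- (a * real k))"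
    using assms zero_notin_angle by (intro abs_Im_inverse_tilde_z_power) auto
  also have "\<dots> \<le> r0 powr (- (a * real k))"
    using assms r0_pos a_pos by (intro powr_mono2') auto
  finally show ?thesis .
qed

lemma integrable_Im_inverse_power:
  assumes [measurable]: "X \<in> sets borel" and X: "X \<subseteq> ball 0 \<rho> \<inter> angle \<alpha> \<beta>"
  shows "set_integrable M X (\<lambda>z. Im (inverse (tilde_z \<alpha> \<beta> z ^ k)))"
proof (rule integrable_bounded_on_ball)
  show "X \<subseteq> cball 0 \<rho>" using X by auto
  show "\<bar>Im (inverse (tilde_z \<alpha> \<beta> z ^ k))\<bar> \<le> r0 powr (- (a * real k))" if "z \<in> X" "r0 \<le> cmod z" for z
    using that X by (intro abs_Im_inverse_le_r0) auto
qed measurable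

lemma abs_integral_Im_inverse_power_le:
  assumes X: "X \<in> sets borel" "X \<subseteq> ball 0 \<rho> \<inter> angle \<alpha> \<beta>" "X \<subseteq> Y"
    and Y: "set_integrable M Y (\<lambda>z. cmod z powr (- (a * real k)))"
  shows "\<bar>LINT z:X|M. Im (inverse (tilde_z \<alpha> \<beta> z ^ k))\<bar> \<le> (LINT z:Y|M. cmod z powr (- (a * real k)))"
proof -
  let ?f = "\<lambda>z. Im (inverse (tilde_z \<alpha> \<beta> z ^ k))"
  have "\<bar>LINT z:X|M. ?f z\<bar> \<le> (LINT z:X|M. \<bar>?f z\<bar>)"
    using set_integral_norm_bound[OF integrable_Im_inverse_power[OF X(1,2), of k]] by simp
  also have "\<dots> \<le> (LINT z:Y|M. cmod z powr (- (a * real k)))"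
    unfolding set_lebesgue_integral_def
  proof (rule integral_mono)
    show "integrable M (\<lambda>z. indicator X z *\<^sub>R \<bar>?f z\<bar>)"
      using set_integrable_abs[OF integrable_Im_inverse_power[OF X(1,2), of k]] by (simp add: set_integrable_def)
    show "integrable M (\<lambda>z. indicator Y z *\<^sub>R cmod z powr (- (a * real k)))"
      using Y by (simp add: set_integrable_def)
    show "indicator X z *\<^sub>R \<bar>?f z\<bar> \<le> indicator Y z *\<^sub>R cmod z powr (- (a * real k))" for z
    proof (cases "z \<in> X")
      case True
      then have "z \<noteq> 0" "z \<in> Y" using X zero_notin_angle by auto
      then show ?thesis
        using True abs_Im_inverse_tilde_z_power[of z k] by simp
    qed simp
  qed
  finally show ?thesis .
qed

lemma power_integral_low:
  assumes k: "a * real k < p"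
  shows "\<exists>C\<ge>0. \<forall>r>0. \<bar>power_integral k r\<bar> \<le> C * r powr (p - a * real k)"
proof (intro exI conjI allI impI)
  let ?s = "a * real k"
  have s: "0 \<le> ?s" using a_pos by simp
  have "2 powr (?s - p) < (1::real)" using k powr_less_cancel_iff[of 2 _ 0] by simp
  then show "0 \<le> K * 2 powr ?s / (1 - 2 powr (?s - p))"
    using K_nonneg by simp
  fix r :: real assume r: "0 < r"
  have "\<bar>power_integral k r\<bar> \<le> (LINT z:ball 0 r|M. cmod z powr (- ?s))"
    unfolding power_integral_def by (intro abs_integral_Im_inverse_power_le[where \<rho> = r] inner_integral(1)[OF s k r]) auto
  also have "\<dots> \<le> K * 2 powr ?s / (1 - 2 powr (?s - p)) * r powr (p - ?s)"
    by (rule inner_integral(2)[OF s k r])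
  finally show "\<bar>power_integral k r\<bar> \<le> K * 2 powr ?s / (1 - 2 powr (?s - p)) * r powr (p - ?s)" .
qed

text \<open>Only the shell between \<open>r\<close> and \<open>c * r\<close> matters: there the
  integrand is at most \<open>r powr (- (a * real k))\<close> and the mass is
  \<open>O(r powr p)\<close>. The estimate holds for every \<open>k\<close>, the critical one
  included.\<close>

lemma power_integral_shift:
  assumes r: "0 < r"
  shows "\<bar>power_integral k (c * r) - power_integral k r\<bar> \<le> K * c powr p * r powr (p - a * real k)"
proof -
  let ?s = "a * real k" and ?f = "\<lambda>z. Im (inverse (tilde_z \<alpha> \<beta> z ^ k))"
  let ?X = "(ball 0 (c * r) - ball 0 r) \<inter> angle \<alpha> \<beta>" and ?Y = "cball 0 (c * r) - ball (0::complex) r"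
  have rc: "r < c * r" using r c_gt_1 by simp
  have s: "0 \<le> ?s" using a_pos by simp
  have "power_integral k (c * r) = (LINT z:(ball 0 r \<inter> angle \<alpha> \<beta>) \<union> ?X|M. ?f z)"
    unfolding power_integral_def using rc by (intro arg_cong[where f = "\<lambda>X. set_lebesgue_integral M X ?f"]) auto
  also have "\<dots> = power_integral k r + (LINT z:?X|M. ?f z)"
    unfolding power_integral_def by (intro set_integral_Un integrable_Im_inverse_power[where \<rho> = r] integrable_Im_inverse_power[where \<rho> = "c * r"]) auto
  finally have "power_integral k (c * r) - power_integral k r = (LINT z:?X|M. ?f z)" by simp
  also have "\<bar>\<dots>\<bar> \<le> (LINT z:?Y|M. cmod z powr (- ?s))"
  proof (rule abs_integral_Im_inverse_power_le[where \<rho> = "c * r"])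
    show "set_integrable M ?Y (\<lambda>z. cmod z powr (- ?s))"
      by (rule integrable_bounded_on_ball[where r = "c * r" and b = "r powr (- ?s)"])
         (use r s in \<open>auto intro: powr_mono2'\<close>)
  qed auto
  also have "\<dots> \<le> (LINT z:?Y|M. r powr (- ?s))"
  proof (rule set_integral_mono)
    show "set_integrable M ?Y (\<lambda>z. cmod z powr (- ?s))"
      by (rule integrable_bounded_on_ball[where r = "c * r" and b = "r powr (- ?s)"])
         (use r s in \<open>auto intro: powr_mono2'\<close>)
    show "set_integrable M ?Y (\<lambda>z. r powr (- ?s))"
      by (rule integrable_bounded_on_ball[where r = "c * r" and b = "r powr (- ?s)"]) auto
    show "cmod z powr (- ?s) \<le> r powr (- ?s)" if "z \<in> ?Y" for z
      using that r s by (intro powr_mono2') auto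
  qed
  also have "\<dots> = measure M ?Y * r powr (- ?s)"
    using finite_emeasure_subset_cball[of ?Y "c * r"] by (subst set_integral_const) (auto simp: less_top)
  also have "\<dots> \<le> K * (c * r) powr p * r powr (- ?s)"
    using rc r by (intro mult_right_mono measure_subset_cball) auto
  also have "\<dots> = K * c powr p * r powr (p - ?s)"
    using r by (simp add: powr_cr powr_diff powr_minus divide_inverse)
  finally show ?thesis .
qed

lemma power_integral_eq_annulus: "power_integral k r = (LINT z:(ball 0 r - ball 0 r0) \<inter> angle \<alpha> \<beta>|M. Im (inverse (tilde_z \<alpha> \<beta> z ^ k)))"
proof -
  have meas: "set_borel_measurable M X (\<lambda>z. Im (inverse (tilde_z \<alpha> \<beta> z ^ k)))"
    if "X \<in> sets borel" "X \<subseteq> ball 0 r \<inter> angle \<alpha> \<beta>" for X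
    using integrable_Im_inverse_power[OF that, of k] unfolding set_borel_measurable_def set_integrable_def
    by (rule borel_measurable_integrable)
  show ?thesis
    unfolding power_integral_def
  proof (rule set_integral_cong_set)
    show "AE z in M. (z \<in> (ball 0 r - ball 0 r0) \<inter> angle \<alpha> \<beta>) = (z \<in> ball 0 r \<inter> angle \<alpha> \<beta>)"
      using AE_ge_r0 by eventually_elim auto
    show "set_borel_measurable M (ball 0 r \<inter> angle \<alpha> \<beta>) (\<lambda>z. Im (inverse (tilde_z \<alpha> \<beta> z ^ k)))"
      "set_borel_measurable M ((ball 0 r - ball 0 r0) \<inter> angle \<alpha> \<beta>) (\<lambda>z. Im (inverse (tilde_z \<alpha> \<beta> z ^ k)))"
      by (rule meas; auto)+
  qed
qed

text \<open>Here \<open>a * real q = p\<close> may occur, so the integral is taken off the null disc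
  and estimated shell by shell; this is the only source of the logarithm.\<close>

lemma power_integral_log:
  assumes r: "r0 \<le> r"
  shows "\<bar>power_integral q r\<bar> \<le> K * 2 powr (a * real q) * r powr (p - a * real q) * (1 + log 2 (r / r0))"
proof -
  let ?s = "a * real q"
  have s: "0 \<le> ?s" using a_pos by simp
  have "\<bar>power_integral q r\<bar> \<le> (LINT z:ball 0 r - ball 0 r0|M. cmod z powr (- ?s))"
    unfolding power_integral_eq_annulus
  proof (rule abs_integral_Im_inverse_power_le[where \<rho> = r])
    show "set_integrable M (ball 0 r - ball 0 r0) (\<lambda>z. cmod z powr (- ?s))"
      by (rule integrable_bounded_on_ball[where r = r and b = "r0 powr (- ?s)"])
         (use r0_pos s in \<open>auto intro: powr_mono2'\<close>)
  qed auto
  also have "\<dots> \<le> K * 2 powr ?s * r powr (p - ?s) * (1 + log 2 (r / r0))"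
    by (rule annulus_integral[OF s genus(1) r])
  finally show ?thesis .
qed

text \<open>The kernel is taken apart only in the near part, since over the whole angle the
  individual negative powers need not be integrable.\<close>

lemma integral_Omega_decomp:
  assumes A: "A \<in> sets borel" "A \<subseteq> cball 0 r" and r: "0 < r"
  shows "(LINT z:angle \<alpha> \<beta>|M. Omega \<alpha> \<beta> q z A)
    = (LINT z:angle \<alpha> \<beta> - ball 0 (c * r)|M. Omega \<alpha> \<beta> q z A)
    + (LINT z:ball 0 (c * r) \<inter> angle \<alpha> \<beta>|M. poisson z A)
    + (\<Sum>k=1..q. power_integral k (c * r) * moment k A)"
proof -
  let ?far = "angle \<alpha> \<beta> - ball 0 (c * r)" and ?near = "ball 0 (c * r) \<inter> angle \<alpha> \<beta>"
  let ?f = "\<lambda>k z. Im (inverse (tilde_z \<alpha> \<beta> z ^ k))"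
  have int: "integrable M (\<lambda>z. indicator ?near z *\<^sub>R (?f k z * moment k A))" for k
    using set_integrable_mult_left[OF integrable_Im_inverse_power[of ?near "c * r"]] by (simp add: set_integrable_def)
  have "(LINT z:angle \<alpha> \<beta>|M. Omega \<alpha> \<beta> q z A) = (LINT z:?far \<union> ?near|M. Omega \<alpha> \<beta> q z A)"
    by (intro arg_cong[where f = "\<lambda>X. set_lebesgue_integral M X _"]) auto
  also have "\<dots> = (LINT z:?far|M. Omega \<alpha> \<beta> q z A) + (LINT z:?near|M. Omega \<alpha> \<beta> q z A)"
    by (intro set_integral_Un set_integrable_subset[OF integrable_Omega[OF A r]]) auto
  also have "(LINT z:?near|M. Omega \<alpha> \<beta> q z A)
      = (LINT z:?near|M. poisson z A) + (LINT z:?near|M. \<Sum>k=1..q. ?f k z * moment k A)"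
    unfolding Omega_split
  proof (intro set_integral_add integrable_poisson[OF A])
    show "set_integrable M ?near (\<lambda>z. \<Sum>k=1..q. ?f k z * moment k A)"
      unfolding set_integrable_def scaleR_sum_right by (intro Bochner_Integration.integrable_sum int)
  qed
  also have "(LINT z:?near|M. \<Sum>k=1..q. ?f k z * moment k A) = (\<Sum>k=1..q. LINT z:?near|M. ?f k z * moment k A)"
    unfolding set_lebesgue_integral_def scaleR_sum_right by (intro Bochner_Integration.integral_sum int)
  also have "\<dots> = (\<Sum>k=1..q. power_integral k (c * r) * moment k A)"
    by (simp only: set_integral_mult_left power_integral_def)
  finally show ?thesis by simp
qed

text \<open>The moment terms are subtracted and not estimated here: their coefficients for the
  positive and the negative part may cancel, and taking absolute values separately would destroy
  that.\<close>

lemma remainder_sum_le: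
  "\<exists>C\<ge>0. \<forall>r>0. \<forall>P. borel_packing r P \<longrightarrow>
     (\<Sum>A\<in>P. \<bar>(LINT z:angle \<alpha> \<beta>|M. Omega \<alpha> \<beta> q z A) + measure M (A - angle \<alpha> \<beta>)
        - (\<Sum>k=1..q. power_integral k (c * r) * moment k A)\<bar>) \<le> C * r powr p"
proof -
  obtain C where C: "0 \<le> C" and far: "\<And>r P. 0 < r \<Longrightarrow> borel_packing r P \<Longrightarrow>
     (\<Sum>A\<in>P. \<bar>LINT z:angle \<alpha> \<beta> - ball 0 (c * r)|M. Omega \<alpha> \<beta> q z A\<bar>) \<le> C * r powr p"
    using far_sum_le by blast
  have "(\<Sum>A\<in>P. \<bar>(LINT z:angle \<alpha> \<beta>|M. Omega \<alpha> \<beta> q z A) + measure M (A - angle \<alpha> \<beta>)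
        - (\<Sum>k=1..q. power_integral k (c * r) * moment k A)\<bar>) \<le> (C + K * c powr p + K) * r powr p"
    if r: "0 < r" and P: "borel_packing r P" for r P
  proof -
    have "(\<Sum>A\<in>P. \<bar>(LINT z:angle \<alpha> \<beta>|M. Omega \<alpha> \<beta> q z A) + measure M (A - angle \<alpha> \<beta>)
        - (\<Sum>k=1..q. power_integral k (c * r) * moment k A)\<bar>)
      \<le> (\<Sum>A\<in>P. \<bar>LINT z:angle \<alpha> \<beta> - ball 0 (c * r)|M. Omega \<alpha> \<beta> q z A\<bar>
          + \<bar>LINT z:ball 0 (c * r) \<inter> angle \<alpha> \<beta>|M. poisson z A\<bar> + \<bar>measure M (A - angle \<alpha> \<beta>)\<bar>)"
    proof (rule sum_mono)
      fix A assume "A \<in> P"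
      from integral_Omega_decomp[OF borel_packingD(3,4)[OF P this] r]
      show "\<bar>(LINT z:angle \<alpha> \<beta>|M. Omega \<alpha> \<beta> q z A) + measure M (A - angle \<alpha> \<beta>)
        - (\<Sum>k=1..q. power_integral k (c * r) * moment k A)\<bar>
        \<le> \<bar>LINT z:angle \<alpha> \<beta> - ball 0 (c * r)|M. Omega \<alpha> \<beta> q z A\<bar>
          + \<bar>LINT z:ball 0 (c * r) \<inter> angle \<alpha> \<beta>|M. poisson z A\<bar> + \<bar>measure M (A - angle \<alpha> \<beta>)\<bar>"
        by linarith
    qed
    also have "\<dots> \<le> C * r powr p + K * c powr p * r powr p + K * r powr p"
      unfolding sum.distrib by (intro add_mono far poisson_sum_le outside_sum_le r P)
    finally show ?thesis by (simp add: algebra_simps)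
  qed
  then show ?thesis
    using C K_nonneg by (intro exI[of _ "C + K * c powr p + K"]) auto
qed

end

subsection \<open>Sweeping a charge\<close>

lemma charge_integral_cong:
  assumes "\<And>z. z \<in> A \<Longrightarrow> f z = g z"
  shows "charge_integral nuP nuN A f = charge_integral nuP nuN A g"
proof -
  have "(\<lambda>z. indicator A z *\<^sub>R f z) = (\<lambda>z. indicator A z *\<^sub>R g z)"
    using assms by (auto simp: indicator_def)
  then show ?thesis
    by (simp only: charge_integral_def set_lebesgue_integral_def)
qed

lemma finite_type_of_eventually_le:
  assumes "eventually (\<lambda>r. rad r \<le> ennreal (C * r powr p)) at_top"
  shows "finite_type rad p"
proof -
  \<comment> \<open>The sign of \<open>C\<close> is not known, and \<open>ennreal\<close> sends
    negative numbers to \<open>0\<close>, so \<open>\<bar>C\<bar>\<close> is used.\<close>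
  have "eventually (\<lambda>r. rad r / ennreal (r powr p) \<le> ennreal \<bar>C\<bar>) at_top"
    using assms eventually_gt_at_top[of 0]
  proof eventually_elim
    case (elim r)
    have "r powr p * C \<le> r powr p * \<bar>C\<bar>"
      by (intro mult_left_mono) auto
    then have "ennreal (C * r powr p) \<le> ennreal (r powr p) * ennreal \<bar>C\<bar>"
      by (simp add: ennreal_leI mult.commute flip: ennreal_mult)
    then have "rad r \<le> ennreal (r powr p) * ennreal \<bar>C\<bar>"
      using elim(1) by (rule order_trans[rotated])
    then show ?case
      using elim(2) by (intro divide_le_posI_ennreal) (auto simp: mult.commute)
  qed
  then have "Limsup at_top (\<lambda>r. rad r / ennreal (r powr p)) \<le> ennreal \<bar>C\<bar>"
    by (rule Limsup_bounded)
  then show ?thesis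
    unfolding finite_type_def using le_less_trans by fastforce
qed

lemma finite_type_global_bound:
  assumes ftype: "finite_type (charge_rad nuP nuN) p" and charge: "is_charge nuP nuN" and p: "0 < p"
    and r0: "0 < r0" "emeasure nuP (ball 0 r0) = 0" "emeasure nuN (ball 0 r0) = 0"
  shows "\<exists>K\<ge>0. \<forall>r\<ge>0. charge_rad nuP nuN r \<le> ennreal (K * r powr p)"
proof -
  have sets: "sets nuP = sets borel" "sets nuN = sets borel"
    using charge by (auto simp: is_charge_def)
  obtain n :: nat where "Limsup at_top (\<lambda>r. charge_rad nuP nuN r / ennreal (r powr p)) < of_nat n"
    using ftype ennreal_Ex_less_of_nat unfolding finite_type_def infinity_ennreal_def by blast
  then have "eventually (\<lambda>r. charge_rad nuP nuN r / ennreal (r powr p) < of_nat n) at_top"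
    by (rule Limsup_lessD)
  then obtain R where R: "\<And>r. R \<le> r \<Longrightarrow> charge_rad nuP nuN r / ennreal (r powr p) < of_nat n"
    by (auto simp: eventually_at_top_linorder)
  have "charge_rad nuP nuN R < \<infinity>"
    using charge by (simp add: is_charge_def charge_rad_def)
  then obtain m where m: "0 \<le> m" "charge_rad nuP nuN R = ennreal m"
    by (cases "charge_rad nuP nuN R" rule: ennreal_cases) auto
  \<comment> \<open>Three ranges of radii: below \<open>r0\<close> the mass is zero, from
    \<open>R\<close> on the limit superior gives the factor \<open>n\<close>, and in between the
    mass is at most \<open>m\<close> while \<open>r powr p\<close> is at least
    \<open>r0 powr p\<close>.\<close>
  define K where "K = real n + m / r0 powr p"
  have K: "0 \<le> K" using m by (simp add: K_def)
  have "charge_rad nuP nuN r \<le> ennreal (K * r powr p)" if r: "0 \<le> r" for r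
  proof -
    consider "r < r0" | "r0 \<le> r" "R \<le> r" | "r0 \<le> r" "r < R" by linarith
    then show ?thesis
    proof cases
      case 1
      then have "cball 0 r \<subseteq> ball (0 :: complex) r0" by auto
      then have "emeasure nuP (cball 0 r) = 0" "emeasure nuN (cball 0 r) = 0"
        using emeasure_mono[of "cball 0 r" "ball 0 r0" nuP] emeasure_mono[of "cball 0 r" "ball 0 r0" nuN] r0 sets
        by auto
      then show ?thesis by (simp add: charge_rad_def)
    next
      case 2
      have rp: "0 < r powr p" using 2 r0 by simp
      have "charge_rad nuP nuN r < of_nat n * ennreal (r powr p)"
        using R[OF 2(2)] rp by (subst (asm) divide_less_ennreal) auto
      also have "\<dots> = ennreal (real n * r powr p)"
        by (simp add: ennreal_of_nat_eq_real_of_nat ennreal_mult)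
      also have "\<dots> \<le> ennreal (K * r powr p)"
        using m by (intro ennreal_leI mult_right_mono) (auto simp: K_def)
      finally show ?thesis by (rule less_imp_le)
    next
      case 3
      have "charge_rad nuP nuN r \<le> charge_rad nuP nuN R"
        unfolding charge_rad_def using 3 sets by (intro add_mono emeasure_mono) auto
      also have "\<dots> = ennreal (m / r0 powr p * r0 powr p)"
        using r0 m by simp
      also have "\<dots> \<le> ennreal (K * r powr p)"
        using 3 r0 p m by (intro ennreal_leI mult_mono powr_mono2) (auto simp: K_def)
      finally show ?thesis .
    qed
  qed
  with K show ?thesis by blast
qed

locale swept_charge = sector \<alpha> \<beta> + pos: swept_measure \<alpha> \<beta> nuP K p r0 q + neg: swept_measure \<alpha> \<beta> nuN K p r0 q
  for \<alpha> \<beta> nuP nuN K p r0 q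
begin

definition charge_power_integral :: "nat \<Rightarrow> real \<Rightarrow> real" where
  "charge_power_integral k r = pos.power_integral k r - neg.power_integral k r"

lemma charge_power_integral_eq:
  "charge_power_integral k r = charge_integral nuP nuN ((ball 0 r - ball 0 r0) \<inter> angle \<alpha> \<beta>)
     (\<lambda>z. Im (inverse (angle_pow \<alpha> (a * real k) z)))"
proof -
  have "charge_power_integral k r = charge_integral nuP nuN ((ball 0 r - ball 0 r0) \<inter> angle \<alpha> \<beta>)
     (\<lambda>z. Im (inverse (tilde_z \<alpha> \<beta> z ^ k)))"
    by (simp only: charge_power_integral_def pos.power_integral_eq_annulus neg.power_integral_eq_annulus charge_integral_def)
  also have "\<dots> = charge_integral nuP nuN ((ball 0 r - ball 0 r0) \<inter> angle \<alpha> \<beta>)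
     (\<lambda>z. Im (inverse (angle_pow \<alpha> (a * real k) z)))"
  proof (rule charge_integral_cong)
    fix z assume "z \<in> (ball 0 r - ball 0 r0) \<inter> angle \<alpha> \<beta>"
    then have "z \<noteq> 0"
      using pos.r0_pos by auto
    then show "Im (inverse (tilde_z \<alpha> \<beta> z ^ k)) = Im (inverse (angle_pow \<alpha> (a * real k) z))"
      by (intro arg_cong[where f = Im] inverse_tilde_z_power)
  qed
  finally show ?thesis .
qed

lemma charge_power_integral_eq_0: "r \<le> r0 \<Longrightarrow> charge_power_integral k r = 0"
proof -
  assume "r \<le> r0"
  then have "ball 0 r - ball 0 r0 = ({} :: complex set)" by auto
  then show ?thesis
    by (simp only: charge_power_integral_eq charge_integral_def Int_empty_left) (simp add: set_lebesgue_integral_def)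
qed

text \<open>The right-hand side of the first assertion without its constant; the other three
  assertions are estimates of this function.\<close>

definition bound :: "real \<Rightarrow> real" where
  "bound r = r powr p + r powr (a * real q) * \<bar>charge_power_integral q r\<bar>"

lemma powr_le_bound: "r powr p \<le> bound r"
  by (simp add: bound_def)

text \<open>For \<open>k < q\<close> the exponent is subcritical and each part alone gives
  \<open>O(r powr p)\<close>. For \<open>k = q\<close> the integral over the smaller disc is kept
  and only the shift of the cut is estimated.\<close>

lemma charge_power_integral_term_le:
  assumes k: "k \<le> q"
  shows "\<exists>C\<ge>0. \<forall>r>0. \<bar>charge_power_integral k (c * r)\<bar> * (r powr a) ^ k \<le> C * bound r"
proof (cases "k = q")
  case True
  \<comment> \<open>The \<open>1\<close> pays for the extra term in \<open>bound\<close>, the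
    \<open>2\<close> for moving the cut in the positive and in the negative part.\<close>
  have "\<bar>charge_power_integral k (c * r)\<bar> * (r powr a) ^ k \<le> (1 + 2 * (K * c powr p)) * bound r" if r: "0 < r" for r
  proof -
    have "\<bar>charge_power_integral q (c * r)\<bar> \<le> \<bar>charge_power_integral q r\<bar> + 2 * (K * c powr p) * r powr (p - a * real q)"
      using pos.power_integral_shift[OF r, of q] neg.power_integral_shift[OF r, of q] unfolding charge_power_integral_def by linarith
    then have "\<bar>charge_power_integral q (c * r)\<bar> * r powr (a * real q)
        \<le> (\<bar>charge_power_integral q r\<bar> + 2 * (K * c powr p) * r powr (p - a * real q)) * r powr (a * real q)"
      by (intro mult_right_mono) auto
    also have "\<dots> = r powr (a * real q) * \<bar>charge_power_integral q r\<bar> + 2 * (K * c powr p) * r powr p"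
      by (simp add: distrib_right mult.assoc flip: powr_add)
    also have "\<dots> \<le> 1 * bound r + 2 * (K * c powr p) * bound r"
      using pos.K_nonneg powr_le_bound[of r]
      by (intro add_mono mult_left_mono) (auto simp: bound_def)
    finally show ?thesis
      unfolding True powr_power_nat[OF r] by (simp add: distrib_right)
  qed
  then show ?thesis
    using pos.K_nonneg by (intro exI[of _ "1 + 2 * (K * c powr p)"]) auto
next
  case False
  then have "a * real k < a * real q" using k a_pos by simp
  then have ap: "a * real k < p" using pos.genus(1) by simp
  obtain C1 C2 where C: "0 \<le> C1" "0 \<le> C2"
    and C1: "\<And>r. 0 < r \<Longrightarrow> \<bar>pos.power_integral k r\<bar> \<le> C1 * r powr (p - a * real k)"
    and C2: "\<And>r. 0 < r \<Longrightarrow> \<bar>neg.power_integral k r\<bar> \<le> C2 * r powr (p - a * real k)"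
    using pos.power_integral_low[OF ap] neg.power_integral_low[OF ap] by blast
  have "\<bar>charge_power_integral k (c * r)\<bar> * (r powr a) ^ k \<le> ((C1 + C2) * c powr (p - a * real k)) * bound r" if r: "0 < r" for r
  proof -
    have cr: "0 < c * r" using r c_gt_1 by simp
    have "\<bar>charge_power_integral k (c * r)\<bar> \<le> (C1 + C2) * (c * r) powr (p - a * real k)"
      using C1[OF cr] C2[OF cr] unfolding charge_power_integral_def distrib_right by linarith
    then have "\<bar>charge_power_integral k (c * r)\<bar> * r powr (a * real k) \<le> (C1 + C2) * (c * r) powr (p - a * real k) * r powr (a * real k)"
      by (intro mult_right_mono) auto
    also have "\<dots> = ((C1 + C2) * c powr (p - a * real k)) * r powr p"
      by (simp add: pos.powr_cr[OF r] mult.assoc flip: powr_add)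
    also have "\<dots> \<le> ((C1 + C2) * c powr (p - a * real k)) * bound r"
      using C powr_le_bound by (intro mult_left_mono) auto
    finally show ?thesis
      unfolding powr_power_nat[OF r] .
  qed
  then show ?thesis
    using C by (intro exI[of _ "(C1 + C2) * c powr (p - a * real k)"]) auto
qed

abbreviation bal :: "complex set \<Rightarrow> real" where
  "bal \<equiv> balayage \<alpha> \<beta> q nuP nuN"

lemma bal_sum_le:
  "\<exists>C\<ge>0. \<forall>r>0. \<forall>P. borel_packing r P \<longrightarrow> (\<Sum>A\<in>P. \<bar>bal A\<bar>) \<le> C * bound r"
proof -
  let ?RP = "\<lambda>r A. (LINT z:angle \<alpha> \<beta>|nuP. Omega \<alpha> \<beta> q z A) + measure nuP (A - angle \<alpha> \<beta>)
        - (\<Sum>k=1..q. pos.power_integral k (c * r) * moment k A)"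
  let ?RN = "\<lambda>r A. (LINT z:angle \<alpha> \<beta>|nuN. Omega \<alpha> \<beta> q z A) + measure nuN (A - angle \<alpha> \<beta>)
        - (\<Sum>k=1..q. neg.power_integral k (c * r) * moment k A)"
  obtain C1 C2 where C: "0 \<le> C1" "0 \<le> C2"
    and C1: "\<And>r P. 0 < r \<Longrightarrow> borel_packing r P \<Longrightarrow> (\<Sum>A\<in>P. \<bar>?RP r A\<bar>) \<le> C1 * r powr p"
    and C2: "\<And>r P. 0 < r \<Longrightarrow> borel_packing r P \<Longrightarrow> (\<Sum>A\<in>P. \<bar>?RN r A\<bar>) \<le> C2 * r powr p"
    using pos.remainder_sum_le neg.remainder_sum_le by blast
  \<comment> \<open>The condition \<open>k \<le> q\<close> stands inside the existential, so that
    choice yields one function \<open>E\<close> that is nonnegative everywhere.\<close>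
  have "\<forall>k. \<exists>C\<ge>0. k \<le> q \<longrightarrow> (\<forall>r>0. \<bar>charge_power_integral k (c * r)\<bar> * (r powr a) ^ k \<le> C * bound r)"
    using charge_power_integral_term_le by blast
  then obtain E where E: "\<And>k. 0 \<le> E k"
    "\<And>k r. k \<le> q \<Longrightarrow> 0 < r \<Longrightarrow> \<bar>charge_power_integral k (c * r)\<bar> * (r powr a) ^ k \<le> E k * bound r"
    by metis
  have "(\<Sum>A\<in>P. \<bar>bal A\<bar>) \<le> (C1 + C2 + (\<Sum>k=1..q. E k)) * bound r"
    if r: "0 < r" and P: "borel_packing r P" for r P
  proof -
    have "(\<Sum>A\<in>P. \<bar>bal A\<bar>) \<le> (\<Sum>A\<in>P. \<bar>?RP r A\<bar> + \<bar>?RN r A\<bar> + (\<Sum>k=1..q. \<bar>charge_power_integral k (c * r)\<bar> * \<bar>moment k A\<bar>))"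
    proof (rule sum_mono)
      fix A
      \<comment> \<open>The moment coefficients of the two parts are merged into integrals against
        the charge before absolute values are taken.\<close>
      have "bal A = ?RP r A - ?RN r A + (\<Sum>k=1..q. charge_power_integral k (c * r) * moment k A)"
        by (simp add: balayage_def charge_integral_def charge_power_integral_def left_diff_distrib sum_subtractf)
      moreover have "\<bar>\<Sum>k=1..q. charge_power_integral k (c * r) * moment k A\<bar> \<le> (\<Sum>k=1..q. \<bar>charge_power_integral k (c * r)\<bar> * \<bar>moment k A\<bar>)"
        unfolding abs_mult[symmetric] by (rule sum_abs)
      ultimately show "\<bar>bal A\<bar> \<le> \<bar>?RP r A\<bar> + \<bar>?RN r A\<bar> + (\<Sum>k=1..q. \<bar>charge_power_integral k (c * r)\<bar> * \<bar>moment k A\<bar>)"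
        by linarith
    qed
    also have "\<dots> = (\<Sum>A\<in>P. \<bar>?RP r A\<bar>) + (\<Sum>A\<in>P. \<bar>?RN r A\<bar>) + (\<Sum>k=1..q. \<bar>charge_power_integral k (c * r)\<bar> * (\<Sum>A\<in>P. \<bar>moment k A\<bar>))"
      using sum.swap[of "\<lambda>k A. \<bar>charge_power_integral k (c * r)\<bar> * \<bar>moment k A\<bar>" P "{1..q}"]
      by (simp only: sum.distrib sum_distrib_left)
    also have "\<dots> \<le> C1 * bound r + C2 * bound r + (\<Sum>k=1..q. E k * bound r)"
    proof (intro add_mono sum_mono)
      show "(\<Sum>A\<in>P. \<bar>?RP r A\<bar>) \<le> C1 * bound r"
        using C1[OF r P] mult_left_mono[OF powr_le_bound C(1)] by (rule order_trans)
      show "(\<Sum>A\<in>P. \<bar>?RN r A\<bar>) \<le> C2 * bound r"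
        using C2[OF r P] mult_left_mono[OF powr_le_bound C(2)] by (rule order_trans)
      fix k assume k: "k \<in> {1..q}"
      have "(\<Sum>A\<in>P. \<bar>moment k A\<bar>) \<le> (r powr a) ^ k"
        using k borel_packingD[OF P] by (intro sum_moment_le) auto
      then have "\<bar>charge_power_integral k (c * r)\<bar> * (\<Sum>A\<in>P. \<bar>moment k A\<bar>) \<le> \<bar>charge_power_integral k (c * r)\<bar> * (r powr a) ^ k"
        by (intro mult_left_mono) auto
      also have "\<dots> \<le> E k * bound r"
        using k by (intro E(2) r) auto
      finally show "\<bar>charge_power_integral k (c * r)\<bar> * (\<Sum>A\<in>P. \<bar>moment k A\<bar>) \<le> E k * bound r" .
    qed
    finally show ?thesis
      by (simp add: distrib_right sum_distrib_right)
  qed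
  then show ?thesis
    using C E(1) by (intro exI[of _ "C1 + C2 + (\<Sum>k=1..q. E k)"]) (auto intro!: sum_nonneg add_nonneg_nonneg)
qed

lemma setfun_rad_bal_le:
  "\<exists>C\<ge>0. \<forall>r\<ge>0. setfun_rad bal r \<le> ennreal (C * bound r)"
proof -
  obtain C where C: "0 \<le> C" "\<And>r P. 0 < r \<Longrightarrow> borel_packing r P \<Longrightarrow> (\<Sum>A\<in>P. \<bar>bal A\<bar>) \<le> C * bound r"
    using bal_sum_le by blast
  have "setfun_rad bal r \<le> ennreal (C * bound r)" if "0 \<le> r" for r
  proof (cases "r = 0")
    case False
    with that C(2)[of r] show ?thesis
      by (intro setfun_rad_le) auto
  next
    case True
    \<comment> \<open>At \<open>r = 0\<close> the right-hand side vanishes, so the balayage must not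
      charge the vertex. A packing of the origin is a packing of every small disc, and for radii
      below \<open>r0\<close> the extra term is zero, so the bound \<open>C * r powr p\<close> tends
      to \<open>0\<close>.\<close>
    have "(\<Sum>A\<in>P. \<bar>bal A\<bar>) \<le> 0" if P: "borel_packing 0 P" for P
    proof (rule tendsto_lowerbound)
      have "((\<lambda>r. r powr p) \<longlongrightarrow> 0 powr p) (at_right 0)"
        using pos.p_pos by (intro tendsto_powr') (auto simp: eventually_at_filter)
      then show "((\<lambda>r. C * r powr p) \<longlongrightarrow> 0) (at_right 0)"
        using tendsto_mult_left[of _ "0::real" _ C] by simp
      have "eventually (\<lambda>r::real. r \<in> {0<..<r0}) (at_right 0)"
        using pos.r0_pos by (rule eventually_at_right_real)
      then show "eventually (\<lambda>r. (\<Sum>A\<in>P. \<bar>bal A\<bar>) \<le> C * r powr p) (at_right 0)"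
      proof eventually_elim
        case (elim r)
        then have "borel_packing r P"
          using P by (auto simp: borel_packing_def)
        then show ?case
          using C(2)[of r P] charge_power_integral_eq_0[of r q] elim by (simp add: bound_def)
      qed
    qed simp
    then have "setfun_rad bal 0 \<le> ennreal 0"
      by (rule setfun_rad_le)
    then show ?thesis using True by simp
  qed
  with C(1) show ?thesis by blast
qed

lemma bounded_subset_cball_pos: "bounded B \<Longrightarrow> \<exists>r>0. B \<subseteq> cball (0 :: complex) r"
  by (auto simp: bounded_pos)

lemma balayage_exists_bal: "balayage_exists \<alpha> \<beta> q nuP nuN"
  unfolding balayage_exists_def
proof (intro conjI ballI impI)
  fix B :: "complex set" assume B: "B \<in> sets borel" "bounded B"
  then obtain r where "0 < r" "B \<subseteq> cball 0 r" using bounded_subset_cball_pos by blast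
  then show "set_integrable nuP (angle \<alpha> \<beta>) (\<lambda>z. Omega \<alpha> \<beta> q z B)"
    "set_integrable nuN (angle \<alpha> \<beta>) (\<lambda>z. Omega \<alpha> \<beta> q z B)"
    using pos.integrable_Omega[OF B(1)] neg.integrable_Omega[OF B(1)] by auto
next
  show "setfun_is_charge bal"
    unfolding setfun_is_charge_def
  proof (intro allI impI)
    fix A :: "nat \<Rightarrow> complex set"
    assume A: "range A \<subseteq> sets borel" "disjoint_family A" and bd: "bounded (\<Union>n. A n)"
    obtain r where r: "0 < r" and Ar: "(\<Union>n. A n) \<subseteq> cball 0 r"
      using bounded_subset_cball_pos[OF bd] by blast
    have An: "A n \<in> sets borel" for n using A by auto
    have out: "(\<Union>n. A n) - angle \<alpha> \<beta> = (\<Union>n. A n - angle \<alpha> \<beta>)" by auto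
    have sub: "(\<Union>n. A n - angle \<alpha> \<beta>) \<subseteq> cball 0 r" using Ar by auto
    have disj: "disjoint_family (\<lambda>n. A n - angle \<alpha> \<beta>)"
      using A(2) by (auto simp: disjoint_family_on_def)
    have "(\<lambda>n. measure nuP (A n - angle \<alpha> \<beta>)) sums measure nuP (\<Union>n. A n - angle \<alpha> \<beta>)"
      using pos.finite_emeasure_subset_cball[OF sub] An disj by (intro measure_UNION) auto
    moreover have "(\<lambda>n. measure nuN (A n - angle \<alpha> \<beta>)) sums measure nuN (\<Union>n. A n - angle \<alpha> \<beta>)"
      using neg.finite_emeasure_subset_cball[OF sub] An disj by (intro measure_UNION) auto
    ultimately show "(\<lambda>n. bal (A n)) sums bal (\<Union>n. A n)"
      unfolding balayage_def charge_integral_def out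
      by (intro sums_add sums_diff pos.integral_Omega_sums[OF A Ar r] neg.integral_Omega_sums[OF A Ar r])
  qed
qed

lemma bound_le_log: "\<exists>C\<ge>0. eventually (\<lambda>r. bound r \<le> C * (r powr p * ln r)) at_top"
proof -
  \<comment> \<open>Twice the constant of \<open>power_integral_log\<close>, once for each part of
    the charge.\<close>
  define B where "B = 2 * (K * 2 powr (a * real q))"
  have B: "0 \<le> B" using pos.K_nonneg by (simp add: B_def)
  \<comment> \<open>From \<open>r = exp 1\<close> on, \<open>ln r\<close> is at least
    \<open>1\<close> and absorbs the constants \<open>1\<close> and
    \<open>\<bar>log 2 r0\<bar>\<close>; the term \<open>1 / ln 2\<close> converts the base of the
    logarithm.\<close>
  define L where "L = 1 + \<bar>log 2 r0\<bar> + 1 / ln 2"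
  have "eventually (\<lambda>r. bound r \<le> (1 + B * L) * (r powr p * ln r)) at_top"
    using eventually_ge_at_top[of "max r0 (exp 1)"]
  proof eventually_elim
    case (elim r)
    have r: "r0 \<le> r" "exp 1 \<le> r" using elim by auto
    have rp: "0 < r" using r pos.r0_pos by simp
    have ln: "1 \<le> ln r" using r rp by (simp add: ln_ge_iff)
    have "\<bar>charge_power_integral q r\<bar> \<le> B * r powr (p - a * real q) * (1 + log 2 (r / r0))"
      using pos.power_integral_log[OF r(1)] neg.power_integral_log[OF r(1)] unfolding charge_power_integral_def B_def by linarith
    also have "\<dots> \<le> B * r powr (p - a * real q) * (L * ln r)"
    proof (intro mult_left_mono)
      have "1 + log 2 (r / r0) \<le> (1 + \<bar>log 2 r0\<bar>) * 1 + 1 / ln 2 * ln r"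
      proof -
        have "log 2 (r / r0) = 1 / ln 2 * ln r - log 2 r0"
          using rp pos.r0_pos by (simp add: log_def ln_div diff_divide_distrib)
        moreover have "- log 2 r0 \<le> \<bar>log 2 r0\<bar>" by simp
        ultimately show ?thesis by (simp only: mult_1_right)
      qed
      also have "\<dots> \<le> (1 + \<bar>log 2 r0\<bar>) * ln r + 1 / ln 2 * ln r"
        using ln by (intro add_right_mono mult_left_mono) auto
      finally show "1 + log 2 (r / r0) \<le> L * ln r"
        by (simp add: L_def distrib_right)
    qed (use B in auto)
    finally have "r powr (a * real q) * \<bar>charge_power_integral q r\<bar> \<le> r powr (a * real q) * (B * r powr (p - a * real q) * (L * ln r))"
      by (intro mult_left_mono) auto
    also have "\<dots> = B * L * (r powr (a * real q) * r powr (p - a * real q)) * ln r"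
      by simp
    also have "\<dots> = B * L * (r powr p * ln r)"
      by (simp flip: powr_add)
    finally have "bound r \<le> r powr p * 1 + B * L * (r powr p * ln r)"
      by (simp add: bound_def)
    also have "\<dots> \<le> r powr p * ln r + B * L * (r powr p * ln r)"
      using ln by (intro add_right_mono mult_left_mono) auto
    finally show ?case by (simp add: distrib_right)
  qed
  moreover have "0 \<le> 1 + B * L" using B by (simp add: L_def)
  ultimately show ?thesis by blast
qed

text \<open>Strictly below the critical exponent the extra term is itself
  \<open>O(r powr p)\<close>, with no cancellation between the two parts.\<close>

lemma bound_le_low_genus:
  assumes "a * real q < p"
  shows "\<exists>C\<ge>0. \<forall>r>0. bound r \<le> C * r powr p"
proof -
  obtain C1 C2 where C: "0 \<le> C1" "0 \<le> C2"
    and C1: "\<And>r. 0 < r \<Longrightarrow> \<bar>pos.power_integral q r\<bar> \<le> C1 * r powr (p - a * real q)"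
    and C2: "\<And>r. 0 < r \<Longrightarrow> \<bar>neg.power_integral q r\<bar> \<le> C2 * r powr (p - a * real q)"
    using pos.power_integral_low[OF assms] neg.power_integral_low[OF assms] by blast
  have "bound r \<le> (1 + C1 + C2) * r powr p" if r: "0 < r" for r
  proof -
    have "\<bar>charge_power_integral q r\<bar> \<le> (C1 + C2) * r powr (p - a * real q)"
      using C1[OF r] C2[OF r] unfolding charge_power_integral_def distrib_right by linarith
    then have "r powr (a * real q) * \<bar>charge_power_integral q r\<bar> \<le> r powr (a * real q) * ((C1 + C2) * r powr (p - a * real q))"
      by (intro mult_left_mono) auto
    also have "\<dots> = (C1 + C2) * (r powr (a * real q) * r powr (p - a * real q))"
      by simp
    also have "\<dots> = (C1 + C2) * r powr p"
      by (simp flip: powr_add)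
    finally show ?thesis
      by (simp add: bound_def distrib_right)
  qed
  then show ?thesis
    using C by (intro exI[of _ "1 + C1 + C2"]) auto
qed

end

section \<open>The four assertions on the balayage of genus \<open>q\<close>, deduced from the
  behaviour of \<open>bound\<close>\<close>

theorem theorem5:
  fixes \<alpha> \<beta> p r0 :: real and nuP nuN :: "complex measure" and q :: nat
  assumes ab: "\<alpha> < \<beta>" "\<beta> \<le> \<alpha> + 2 * pi"
    and charge: "is_charge nuP nuN"
    and p: "0 < p"
    and ftype: "finite_type (charge_rad nuP nuN) p"
    and q: "q = nat \<lfloor>(\<beta> - \<alpha>) / pi * p\<rfloor>"
    and r0: "0 < r0" "emeasure nuP (ball 0 r0) = 0" "emeasure nuN (ball 0 r0) = 0"
  shows
    "balayage_exists \<alpha> \<beta> q nuP nuN \<and>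
     (\<exists>C. \<forall>r\<ge>0. setfun_rad (balayage \<alpha> \<beta> q nuP nuN) r \<le>
        ennreal (C * (r powr p + r powr (pi * q / (\<beta> - \<alpha>)) *
          \<bar>charge_integral nuP nuN ((ball 0 r - ball 0 r0) \<inter> angle \<alpha> \<beta>)
             (\<lambda>z. Im (inverse (angle_pow \<alpha> (pi * q / (\<beta> - \<alpha>)) z)))\<bar>))) \<and>
     (\<exists>C. eventually (\<lambda>r. setfun_rad (balayage \<alpha> \<beta> q nuP nuN) r \<le>
        ennreal (C * (r powr p * ln r))) at_top) \<and>
     ((\<beta> - \<alpha>) / pi * p \<notin> \<nat> \<longrightarrow> finite_type (setfun_rad (balayage \<alpha> \<beta> q nuP nuN)) p) \<and>
     ((real q = (\<beta> - \<alpha>) / pi * p \<and>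
       (\<exists>M. eventually (\<lambda>r. \<bar>charge_integral nuP nuN ((ball 0 r - ball 0 r0) \<inter> angle \<alpha> \<beta>)
             (\<lambda>z. Im (inverse (angle_pow \<alpha> p z)))\<bar> \<le> M) at_top))
       \<longrightarrow> finite_type (setfun_rad (balayage \<alpha> \<beta> q nuP nuN)) p)"
proof -
  obtain K where K: "0 \<le> K" "\<And>r. 0 \<le> r \<Longrightarrow> charge_rad nuP nuN r \<le> ennreal (K * r powr p)"
    using finite_type_global_bound[OF ftype charge p r0] by blast
  interpret sector \<alpha> \<beta>
    by unfold_locales (use ab in auto)
  have x: "(\<beta> - \<alpha>) / pi * p = p / a"
    by (simp add: a_def)
  moreover have "0 \<le> p / a"
    using a_pos p by simp
  ultimately have "real q \<le> p / a" "p / a < real q + 1"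
    unfolding q by linarith+
  then have genus: "a * real q \<le> p" "p < a * real (q + 1)"
    using a_pos by (simp_all add: field_simps)
  \<comment> \<open>Both parts are dominated by the total variation, so one constant
    \<open>K\<close> serves both.\<close>
  have growth: "emeasure nuP (cball 0 r) \<le> ennreal (K * r powr p)"
    "emeasure nuN (cball 0 r) \<le> ennreal (K * r powr p)" if "0 \<le> r" for r
    using K(2)[OF that] unfolding charge_rad_def by (auto intro: order_trans[rotated])
  interpret swept_charge \<alpha> \<beta> nuP nuN K p r0 q
    by unfold_locales (use charge p r0 K growth genus in \<open>auto simp: is_charge_def\<close>)
  have exponent: "pi * q / (\<beta> - \<alpha>) = a * real q"
    by (simp add: a_def)
  obtain C where C: "0 \<le> C" "\<And>r. 0 \<le> r \<Longrightarrow> setfun_rad bal r \<le> ennreal (C * bound r)"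
    using setfun_rad_bal_le by blast
  have le_if: "setfun_rad bal r \<le> ennreal (C * E * X)" if "0 \<le> r" "bound r \<le> E * X" for r E X
    using C(2)[OF that(1)] ennreal_leI[OF mult_left_mono[OF that(2) C(1)]] by (simp add: mult.assoc)
  show ?thesis
  proof (intro conjI impI)
    show "balayage_exists \<alpha> \<beta> q nuP nuN"
      by (rule balayage_exists_bal)
    show "\<exists>C. \<forall>r\<ge>0. setfun_rad bal r \<le>
        ennreal (C * (r powr p + r powr (pi * q / (\<beta> - \<alpha>)) *
          \<bar>charge_integral nuP nuN ((ball 0 r - ball 0 r0) \<inter> angle \<alpha> \<beta>)
             (\<lambda>z. Im (inverse (angle_pow \<alpha> (pi * q / (\<beta> - \<alpha>)) z)))\<bar>))"
      using C(2) unfolding bound_def charge_power_integral_eq exponent by blast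
    obtain E where "eventually (\<lambda>r. bound r \<le> E * (r powr p * ln r)) at_top"
      using bound_le_log by blast
    then have "eventually (\<lambda>r. setfun_rad bal r \<le> ennreal (C * E * (r powr p * ln r))) at_top"
      using eventually_ge_at_top[of 0] by eventually_elim (rule le_if)
    then show "\<exists>C. eventually (\<lambda>r. setfun_rad bal r \<le> ennreal (C * (r powr p * ln r))) at_top"
      by blast
  next
    assume "(\<beta> - \<alpha>) / pi * p \<notin> \<nat>"
    \<comment> \<open>When \<open>p / a\<close> is not an integer it differs from its integer part
      \<open>q\<close>, which makes the exponent \<open>a * real q\<close> strictly
      subcritical.\<close>
    then have "real q \<noteq> p / a"
      unfolding x by (metis of_nat_in_Nats)
    then have "a * real q < p"
      using genus(1) a_pos by (auto simp: field_simps order.order_iff_strict)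
    then obtain E where E: "\<And>r. 0 < r \<Longrightarrow> bound r \<le> E * r powr p"
      using bound_le_low_genus by blast
    have "eventually (\<lambda>r. setfun_rad bal r \<le> ennreal (C * E * r powr p)) at_top"
      using eventually_gt_at_top[of 0] by eventually_elim (auto intro: le_if E)
    then show "finite_type (setfun_rad bal) p"
      by (rule finite_type_of_eventually_le)
  next
    assume *: "real q = (\<beta> - \<alpha>) / pi * p \<and>
       (\<exists>M. eventually (\<lambda>r. \<bar>charge_integral nuP nuN ((ball 0 r - ball 0 r0) \<inter> angle \<alpha> \<beta>)
             (\<lambda>z. Im (inverse (angle_pow \<alpha> p z)))\<bar> \<le> M) at_top)"
    \<comment> \<open>In the critical case the branch with exponent \<open>p\<close> in the Blaschke
      condition is the one in \<open>charge_power_integral q\<close>, and the factor before the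
      integral in \<open>bound\<close> is \<open>r powr p\<close>.\<close>
    then have aq: "a * real q = p"
      using a_pos unfolding x by (simp add: field_simps del: inverse_complex.sel)
    with * obtain M where "eventually (\<lambda>r. \<bar>charge_power_integral q r\<bar> \<le> M) at_top"
      unfolding charge_power_integral_eq by auto
    then have "eventually (\<lambda>r. setfun_rad bal r \<le> ennreal (C * (1 + M) * r powr p)) at_top"
      using eventually_ge_at_top[of 0]
    proof eventually_elim
      case (elim r)
      then have "r powr p * \<bar>charge_power_integral q r\<bar> \<le> r powr p * M"
        by (intro mult_left_mono) auto
      then have "bound r \<le> (1 + M) * r powr p"
        unfolding bound_def aq by (simp add: algebra_simps)
      with elim show ?case by (intro le_if)
    qed
    then show "finite_type (setfun_rad bal) p"
      by (rule finite_type_of_eventually_le)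
  qed
qed

end
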